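(* Let $X,M$ be manifolds such that $X$ is compact and $M$ is suitable. If $f,h:X\to M$ are maps such that $N(f,h)=0$, where $N(f,h)$ is the geometric Nielsen coincidence number, then there exists a map $h'$ homotopic to $h$ such that $Coin(f,h')=\emptyset$.
   Context: All maps are continuous. A manifold $M$, with a chosen point $e\in M$, is called suitable if there exists a continuous map $\theta:M\to G(M)$, where $G(M)$ is the group of all homeomorphisms of $M$, such that $\theta(x)(x)=e$ for all $x\in M$ and $\theta(e)=\mathrm{id}_M$. ($M$ need not be compact, and $X$, $M$ may have different dimensions.) $Coin(f,h)=\{x\in X:f(x)=h(x)\}$. Two points $x,y\in Coin(f,h)$ are Nielsen equivalent if there is a path $\gamma$ in $X$ from $x$ to $y$ with $f\circ\gamma\sim h\circ\gamma$ relative to endpoints; the equivalence classes are the coincidence classes. Given homotopies $F,H:X\times I\to M$ with $F_0=f$, $H_0=h$, a coincidence class $C$ of $(f,h)$ is related to a coincidence class $C'$ of $(F_1,H_1)$ if there is a path $\lambda$ in $X$ from a point of $C$ to a point of $C'$ such that the paths $t\mapsto F(\lambda(t),t)$ and $t\mapsto H(\lambda(t),t)$ are homotopic relative to endpoints. A class $C$ is geometrically inessential if there are such homotopies $F,H$ for which $C$ is related to no (nonempty) coincidence class of $(F_1,H_1)$; otherwise it is geometrically essential. The geometric Nielsen number $N(f,h)$ is the number of geometrically essential coincidence classes of $(f,h)$. *)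

theory Defs
  imports "HOL-Analysis.Analysis" "HOL-Library.Extended_Nat"
begin

text \<open>
  Spaces are subsets of arbitrary topological-space types with the subspace topology (so the
  empty manifold is included).  Manifolds are topological manifolds without boundary of some fixed
  dimension; neither connectedness nor compactness is built in.
\<close>

definition manifold :: "'a::topological_space set \<Rightarrow> bool" where
  "manifold X \<longleftrightarrow>
     Hausdorff_space (top_of_set X) \<and> second_countable (top_of_set X) \<and>
     (\<exists>n. \<forall>x\<in>X. \<exists>U V. openin (top_of_set X) U \<and> x \<in> U \<and> openin (Euclidean_space n) V \<and>
        top_of_set U homeomorphic_space subtopology (Euclidean_space n) V)"

text \<open>
  Self-homeomorphisms of \<open>M\<close> are normalised to be \<open>undefined\<close> outside \<open>M\<close>, so that each
  homeomorphism is represented by exactly one function.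
\<close>

definition homeo_group :: "'a::topological_space set \<Rightarrow> ('a \<Rightarrow> 'a) set" where
  "homeo_group M = {g \<in> extensional M. \<exists>g'. homeomorphism M M g g'}"

text \<open>The compact-open topology; the choice \<open>K = {}\<close> makes its carrier all of \<open>homeo_group M\<close>.\<close>

definition homeo_group_topology :: "'a::topological_space set \<Rightarrow> ('a \<Rightarrow> 'a) topology" where
  "homeo_group_topology M =
     topology_generated_by
       {{g \<in> homeo_group M. g ` K \<subseteq> U} |K U. compact K \<and> K \<subseteq> M \<and> openin (top_of_set M) U}"

lemma topspace_homeo_group_topology: "topspace (homeo_group_topology M) = homeo_group M"
proof -
  have "homeo_group M \<in>
      {{g \<in> homeo_group M. g ` K \<subseteq> U} |K U. compact K \<and> K \<subseteq> M \<and> openin (top_of_set M) U}"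
    by (auto intro!: exI[of _ "{}"])
  then show ?thesis
    unfolding homeo_group_topology_def topology_generated_by_topspace by blast
qed

definition suitable :: "'a::topological_space set \<Rightarrow> bool" where
  "suitable M \<longleftrightarrow>
     (\<exists>e\<in>M. \<exists>\<theta>. continuous_map (top_of_set M) (homeo_group_topology M) \<theta> \<and>
        (\<forall>x\<in>M. \<theta> x x = e) \<and> \<theta> e = restrict id M)"

definition Coin :: "'a set \<Rightarrow> ('a \<Rightarrow> 'b) \<Rightarrow> ('a \<Rightarrow> 'b) \<Rightarrow> 'a set" where
  "Coin X f h = {x \<in> X. f x = h x}"

definition nielsen_rel ::
    "'a::topological_space set \<Rightarrow> 'b::topological_space set \<Rightarrow> ('a \<Rightarrow> 'b) \<Rightarrow> ('a \<Rightarrow> 'b) \<Rightarrow> ('a \<times> 'a) set"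
  where
  "nielsen_rel X M f h =
     {(x, y). x \<in> Coin X f h \<and> y \<in> Coin X f h \<and>
        (\<exists>\<gamma>. path \<gamma> \<and> path_image \<gamma> \<subseteq> X \<and> pathstart \<gamma> = x \<and> pathfinish \<gamma> = y \<and>
           homotopic_paths M (f \<circ> \<gamma>) (h \<circ> \<gamma>))}"

definition coincidence_classes ::
    "'a::topological_space set \<Rightarrow> 'b::topological_space set \<Rightarrow> ('a \<Rightarrow> 'b) \<Rightarrow> ('a \<Rightarrow> 'b) \<Rightarrow> 'a set set"
  where
  "coincidence_classes X M f h = Coin X f h // nielsen_rel X M f h"

definition homotopy_from ::
    "'a::topological_space set \<Rightarrow> 'b::topological_space set \<Rightarrow> ('a \<times> real \<Rightarrow> 'b) \<Rightarrow> ('a \<Rightarrow> 'b) \<Rightarrow> bool"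
  where
  "homotopy_from X M F f \<longleftrightarrow>
     continuous_on (X \<times> {0..1}) F \<and> F ` (X \<times> {0..1}) \<subseteq> M \<and> (\<forall>x\<in>X. F (x, 0) = f x)"

definition related_classes ::
    "'a::topological_space set \<Rightarrow> 'b::topological_space set \<Rightarrow>
      ('a \<times> real \<Rightarrow> 'b) \<Rightarrow> ('a \<times> real \<Rightarrow> 'b) \<Rightarrow> 'a set \<Rightarrow> 'a set \<Rightarrow> bool"
  where
  "related_classes X M F H C C' \<longleftrightarrow>
     (\<exists>p. path p \<and> path_image p \<subseteq> X \<and> pathstart p \<in> C \<and> pathfinish p \<in> C' \<and>
        homotopic_paths M (\<lambda>t. F (p t, t)) (\<lambda>t. H (p t, t)))"

definition geom_inessential ::
    "'a::topological_space set \<Rightarrow> 'b::topological_space set \<Rightarrow> ('a \<Rightarrow> 'b) \<Rightarrow> ('a \<Rightarrow> 'b) \<Rightarrow> 'a set \<Rightarrow> bool"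
  where
  "geom_inessential X M f h C \<longleftrightarrow>
     (\<exists>F H. homotopy_from X M F f \<and> homotopy_from X M H h \<and>
        \<not> (\<exists>C' \<in> coincidence_classes X M (\<lambda>x. F (x, 1)) (\<lambda>x. H (x, 1)).
              related_classes X M F H C C'))"

definition essential_classes ::
    "'a::topological_space set \<Rightarrow> 'b::topological_space set \<Rightarrow> ('a \<Rightarrow> 'b) \<Rightarrow> ('a \<Rightarrow> 'b) \<Rightarrow> 'a set set"
  where
  "essential_classes X M f h =
     {C \<in> coincidence_classes X M f h. \<not> geom_inessential X M f h C}"

text \<open>
  Values in \<^typ>\<open>enat\<close>, because \<^const>\<open>card\<close> alone would give \<open>0\<close> for an infinite set of classes.
\<close>

definition nielsen_number ::
    "'a::topological_space set \<Rightarrow> 'b::topological_space set \<Rightarrow> ('a \<Rightarrow> 'b) \<Rightarrow> ('a \<Rightarrow> 'b) \<Rightarrow> enat"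
  where
  "nielsen_number X M f h =
     (if finite (essential_classes X M f h) then enat (card (essential_classes X M f h)) else \<infinity>)"

end

theory Submission
  imports Defs
begin

text \<open>
  With \<open>\<theta> : M \<rightarrow> G(M)\<close> as in the definition of a suitable manifold, coincidences of \<open>(f, h)\<close> are
  the roots at \<open>e\<close> of \<open>g x = \<theta> (f x) (h x)\<close>, homotopies of \<open>g\<close> translate into homotopies of \<open>h\<close>
  alone because \<open>\<theta> (f x)\<close> is invertible, and inessential coincidence classes of \<open>(f, h)\<close> give
  inessential root classes of \<open>g\<close>.  On a component of \<open>X\<close> containing a root, lift \<open>g\<close> to the
  covering of \<open>M\<close> belonging to the image of \<open>\<pi>\<^sub>1(X)\<close>.  That one root class can be removed means that,
  after a homotopy, the lift misses one point over \<open>e\<close>.  A map that misses one point of a cell can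
  be pushed radially off the whole cell, so by following a chain of cells along a path the
  lift can be made to miss any further given point over \<open>e\<close>, without hitting points over \<open>e\<close> that it
  did not hit before.  By compactness finitely many such pushes remove all roots.
\<close>

subsection \<open>Cells in manifolds\<close>

text \<open>The hypothesis removes each coincidence class by a homotopy of its own, and such
  homotopies need not combine. Nor can one that removes a single root class simply be carried to the
  others: the root argument concerns maps into an arbitrary manifold (suitability enters through
  \<open>suitable_division\<close>), where the covering may have too few deck transformations. So it
  is the missed point that travels, not the homotopy. On each path component with a root, one
  inessential class is used once, and the fibre point that it frees is slid through the covering to
  the other ones. Every move is a radial push in a cell, so no general position and no relation
  between the dimensions of \<open>X\<close> and \<open>M\<close> enter. The cells are chosen with
  \<open>e\<close> off \<open>D - B\<close>, where pushed points end; hence no push creates a root,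
  and a missed point over \<open>e\<close> stays missed. Missed points over other points of
  \<open>M\<close> may be hit again. The constant path at \<open>e\<close> thus remains available as
  the start of every later chain.\<close>

definition coord_space :: "nat \<Rightarrow> (nat \<Rightarrow> real) set" where
  "coord_space n = {x. \<forall>i\<ge>n. x i = 0}"

lemma Euclidean_space_eq_coord_space: "Euclidean_space n = top_of_set (coord_space n)"
  by (simp add: Euclidean_space_def coord_space_def euclidean_product_topology)

text \<open>Cubes replace balls because \<open>coord_space n\<close> carries the product topology:
  bounds on the first \<open>n\<close> coordinates suffice. For \<open>n = 0\<close> both cubes are
  a single point, whatever \<open>r\<close> is.\<close>

definition open_cube :: "nat \<Rightarrow> (nat \<Rightarrow> real) \<Rightarrow> real \<Rightarrow> (nat \<Rightarrow> real) set" where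
  "open_cube n c r = {x \<in> coord_space n. \<forall>i<n. \<bar>x i - c i\<bar> < r}"

definition closed_cube :: "nat \<Rightarrow> (nat \<Rightarrow> real) \<Rightarrow> real \<Rightarrow> (nat \<Rightarrow> real) set" where
  "closed_cube n c r = {x \<in> coord_space n. \<forall>i<n. \<bar>x i - c i\<bar> \<le> r}"

lemma open_cube_subset_closed_cube: "open_cube n c r \<subseteq> closed_cube n c r"
  by (auto simp: open_cube_def closed_cube_def intro: less_imp_le)

lemma openin_open_cube: "openin (top_of_set (coord_space n)) (open_cube n c r)"
proof -
  have "open {x :: nat \<Rightarrow> real. \<bar>x i - c i\<bar> < r}" for i
    by (intro open_Collect_less continuous_intros)
       (auto intro: continuous_on_product_then_coordinatewise continuous_on_id)
  then have "open (\<Inter>i<n. {x :: nat \<Rightarrow> real. \<bar>x i - c i\<bar> < r})"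
    by (intro open_INT) auto
  moreover have "open_cube n c r = coord_space n \<inter> (\<Inter>i<n. {x. \<bar>x i - c i\<bar> < r})"
    by (auto simp: open_cube_def)
  ultimately show ?thesis
    by (simp add: openin_open_Int)
qed

text \<open>Tychonoff: the cube is a full product of compact intervals below \<open>n\<close> and
  singletons from \<open>n\<close> on.\<close>

lemma compact_closed_cube:
  assumes "c \<in> coord_space n"
  shows "compact (closed_cube n c r)"
proof -
  define I where "I i = (if i < n then {c i - r..c i + r} else {0})" for i
  have "compactin (product_topology (\<lambda>i. euclidean) UNIV) (PiE UNIV I)"
    unfolding compactin_PiE by (auto simp: I_def)
  moreover have "PiE UNIV I = closed_cube n c r"
  proof -
    have "(x \<in> PiE UNIV I) = (x \<in> closed_cube n c r)" for x
    proof -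
      have "x i \<in> I i \<longleftrightarrow> (if i < n then \<bar>x i - c i\<bar> \<le> r else x i = 0)" for i
        unfolding I_def by (auto split: if_splits)
      then show ?thesis
        by (auto simp: closed_cube_def coord_space_def PiE_def Pi_def)
    qed
    then show ?thesis by blast
  qed
  ultimately show ?thesis
    by (simp add: euclidean_product_topology)
qed

lemma closed_cube_in_open:
  assumes "openin (top_of_set (coord_space n)) V" "c \<in> V"
  obtains r where "r > 0" "closed_cube n c r \<subseteq> V"
proof -
  obtain T where T: "open T" "V = coord_space n \<inter> T"
    using assms(1) by (auto simp: openin_open)
  have "openin (product_topology (\<lambda>i. euclidean) UNIV) T"
    using T(1) by (simp add: euclidean_product_topology)
  then obtain Y where Y: "c \<in> PiE UNIV Y" "\<And>i. open (Y i)" "PiE UNIV Y \<subseteq> T"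
    using product_topology_open_contains_basis[of "\<lambda>i. euclidean" UNIV T c] T assms(2) by auto
  have "\<exists>d>0. \<forall>y. \<bar>y - c i\<bar> \<le> d \<longrightarrow> y \<in> Y i" for i
  proof -
    have "c i \<in> Y i" using Y(1) by auto
    then obtain d where "d > 0" "cball (c i) d \<subseteq> Y i"
      using Y(2) open_contains_cball by blast
    then show ?thesis by (intro exI[of _ d]) (auto simp: subset_iff dist_real_def abs_minus_commute)
  qed
  then obtain d where d: "\<And>i. d i > 0" "\<And>i y. \<bar>y - c i\<bar> \<le> d i \<Longrightarrow> y \<in> Y i"
    by metis
  \<comment> \<open>The extra 1 keeps \<open>Min\<close> meaningful when
    \<open>n = 0\<close>.\<close>
  define r where "r = Min (insert 1 (d ` {..<n}))"
  have r: "r > 0" "\<And>i. i < n \<Longrightarrow> r \<le> d i"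
    using d(1) by (auto simp: r_def)
  have "closed_cube n c r \<subseteq> V"
  proof
    fix x assume x: "x \<in> closed_cube n c r"
    have "x i \<in> Y i" for i
    proof (cases "i < n")
      case True
      with x r(2)[of i] show ?thesis by (intro d) (auto simp: closed_cube_def)
    next
      case False
      then have "x i = c i"
        using x assms(2) T(2) by (auto simp: closed_cube_def coord_space_def)
      then show ?thesis using Y(1) by auto
    qed
    then show "x \<in> V"
      using Y(3) x T(2) by (auto simp: closed_cube_def)
  qed
  with r that show ?thesis by blast
qed

text \<open>The Minkowski gauge, with respect to its interior point \<open>a\<close>, of the cube with centre \<open>c\<close>
  and half side \<open>r\<close>; it avoids \<^const>\<open>Max\<close> of an empty set in dimension 0.\<close>

fun cube_gauge :: "(nat \<Rightarrow> real) \<Rightarrow> real \<Rightarrow> (nat \<Rightarrow> real) \<Rightarrow> nat \<Rightarrow> (nat \<Rightarrow> real) \<Rightarrow> real" where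
  "cube_gauge c r a 0 x = 0"
| "cube_gauge c r a (Suc n) x =
     max (cube_gauge c r a n x)
       (max ((x n - a n) / (c n + r - a n)) ((a n - x n) / (a n - c n + r)))"

lemma cube_gauge_nonneg: "cube_gauge c r a n x \<ge> 0"
  by (induction n) auto

lemma continuous_on_cube_gauge: "continuous_on S (\<lambda>x. cube_gauge c r a n x)"
proof (induction n)
  case 0
  show ?case by (simp only: cube_gauge.simps continuous_on_const)
next
  case (Suc n)
  have "continuous_on S (\<lambda>x :: nat \<Rightarrow> real. x n)"
    using continuous_on_product_then_coordinatewise[OF continuous_on_id] .
  with Suc show ?case
    by (simp only: cube_gauge.simps divide_inverse) (intro continuous_intros)
qed

text \<open>In coordinate \<open>n\<close> the two quotients measure the displacement of
  \<open>x n\<close> from \<open>a n\<close> relative to the distance from \<open>a n\<close> to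
  either face. Both denominators are positive because \<open>a\<close> is interior.\<close>

lemma cube_gauge_le_1:
  assumes "\<forall>i<n. \<bar>a i - c i\<bar> < r"
  shows "cube_gauge c r a n x \<le> 1 \<longleftrightarrow> (\<forall>i<n. \<bar>x i - c i\<bar> \<le> r)"
  using assms
proof (induction n)
  case (Suc n)
  have pos: "c n + r - a n > 0" "a n - c n + r > 0"
    using Suc.prems[rule_format, OF lessI] by linarith+
  have "(x n - a n) / (c n + r - a n) \<le> 1 \<longleftrightarrow> x n - c n \<le> r"
       "(a n - x n) / (a n - c n + r) \<le> 1 \<longleftrightarrow> - (x n - c n) \<le> r"
    unfolding pos_divide_le_eq[OF pos(1)] pos_divide_le_eq[OF pos(2)] by auto
  moreover have "\<bar>x n - c n\<bar> \<le> r \<longleftrightarrow> x n - c n \<le> r \<and> - (x n - c n) \<le> r"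
    by (rule abs_le_iff)
  ultimately have "cube_gauge c r a (Suc n) x \<le> 1 \<longleftrightarrow> cube_gauge c r a n x \<le> 1 \<and> \<bar>x n - c n\<bar> \<le> r"
    by (simp only: cube_gauge.simps max.bounded_iff)
  moreover have "cube_gauge c r a n x \<le> 1 \<longleftrightarrow> (\<forall>i<n. \<bar>x i - c i\<bar> \<le> r)"
    using Suc by simp
  ultimately show ?case
    by (simp only: less_Suc_eq) blast
qed auto

lemma cube_gauge_less_1:
  assumes "\<forall>i<n. \<bar>a i - c i\<bar> < r"
  shows "cube_gauge c r a n x < 1 \<longleftrightarrow> (\<forall>i<n. \<bar>x i - c i\<bar> < r)"
  using assms
proof (induction n)
  case (Suc n)
  have pos: "c n + r - a n > 0" "a n - c n + r > 0"
    using Suc.prems[rule_format, OF lessI] by linarith+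
  have "(x n - a n) / (c n + r - a n) < 1 \<longleftrightarrow> x n - c n < r"
       "(a n - x n) / (a n - c n + r) < 1 \<longleftrightarrow> - (x n - c n) < r"
    unfolding pos_divide_less_eq[OF pos(1)] pos_divide_less_eq[OF pos(2)] by auto
  moreover have "\<bar>x n - c n\<bar> < r \<longleftrightarrow> x n - c n < r \<and> - (x n - c n) < r"
    by (rule abs_less_iff)
  ultimately have "cube_gauge c r a (Suc n) x < 1 \<longleftrightarrow> cube_gauge c r a n x < 1 \<and> \<bar>x n - c n\<bar> < r"
    by (simp only: cube_gauge.simps max_less_iff_conj)
  moreover have "cube_gauge c r a n x < 1 \<longleftrightarrow> (\<forall>i<n. \<bar>x i - c i\<bar> < r)"
    using Suc by simp
  ultimately show ?case
    by (simp only: less_Suc_eq) blast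
qed auto

lemma cube_gauge_eq_0:
  assumes "\<forall>i<n. \<bar>a i - c i\<bar> < r" "cube_gauge c r a n x = 0" "i < n"
  shows "x i = a i"
  using assms
proof (induction n)
  case (Suc n)
  have *: "c n + r - a n > 0" "a n - c n + r > 0"
    using Suc.prems(1)[rule_format, OF lessI] by linarith+
  have "cube_gauge c r a n x = 0" "(x n - a n) / (c n + r - a n) \<le> 0" "(a n - x n) / (a n - c n + r) \<le> 0"
    using Suc.prems(2) cube_gauge_nonneg[of c r a n x]
    unfolding cube_gauge.simps by linarith+
  moreover from this(2,3) have "x n = a n"
    unfolding pos_divide_le_eq[OF *(1)] pos_divide_le_eq[OF *(2)] by linarith
  ultimately show ?case
    using Suc.IH Suc.prems(1,3) less_Suc_eq by metis
qed simp

lemma cube_gauge_scale: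
  assumes "s \<ge> 0"
  shows "cube_gauge c r a n (\<lambda>i. a i + s * (x i - a i)) = s * cube_gauge c r a n x"
  using assms
proof (induction n)
  case (Suc n)
  have 1: "a n + s * (x n - a n) - a n = s * (x n - a n)" "a n - (a n + s * (x n - a n)) = s * (a n - x n)"
    by (simp_all add: algebra_simps)
  have 2: "s * max u v = max (s * u) (s * v)" for u v
    using Suc.prems by (simp add: max_mult_distrib_left)
  show ?case
    unfolding cube_gauge.simps Suc.IH[OF Suc.prems] 1 2 times_divide_eq_right ..
qed auto

lemma mem_closed_cube_iff_gauge:
  assumes "a \<in> open_cube n c r"
  shows "x \<in> closed_cube n c r \<longleftrightarrow> x \<in> coord_space n \<and> cube_gauge c r a n x \<le> 1"
  using assms cube_gauge_le_1[of n a c r x] by (auto simp: closed_cube_def open_cube_def)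

lemma mem_open_cube_iff_gauge:
  assumes "a \<in> open_cube n c r"
  shows "x \<in> open_cube n c r \<longleftrightarrow> x \<in> coord_space n \<and> cube_gauge c r a n x < 1"
  using assms cube_gauge_less_1[of n a c r x] by (auto simp: open_cube_def)

lemma cube_gauge_pos:
  assumes "a \<in> open_cube n c r" "x \<in> coord_space n" "x \<noteq> a"
  shows "cube_gauge c r a n x > 0"
proof (rule ccontr)
  assume "\<not> ?thesis"
  then have 0: "cube_gauge c r a n x = 0"
    using cube_gauge_nonneg[of c r a n x] by linarith
  have "x i = a i" for i
  proof (cases "i < n")
    case True
    then show ?thesis
      using cube_gauge_eq_0[OF _ 0] assms(1) by (auto simp: open_cube_def)
  qed (use assms in \<open>auto simp: open_cube_def coord_space_def\<close>)
  with assms(3) show False by auto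
qed

text \<open>The straight-line homotopy to the radial projection from \<open>a\<close> onto the boundary.\<close>

definition cube_push ::
    "(nat \<Rightarrow> real) \<Rightarrow> real \<Rightarrow> (nat \<Rightarrow> real) \<Rightarrow> nat \<Rightarrow> (nat \<Rightarrow> real) \<times> real \<Rightarrow> (nat \<Rightarrow> real)" where
  "cube_push c r a n =
     (\<lambda>(x, t) i. a i + (1 - t + t / cube_gauge c r a n x) * (x i - a i))"

lemma cube_push_0 [simp]: "cube_push c r a n (x, 0) = x"
  by (simp add: cube_push_def)

text \<open>The push moves \<open>x\<close> along the ray from \<open>a\<close>, on which the gauge
  is homogeneous. So the gauge interpolates linearly from its old value to 1, the value on the
  boundary; both membership statements about pushed points follow from this formula.\<close>

lemma cube_gauge_push:
  assumes "t \<in> {0..1}" "cube_gauge c r a n x > 0"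
  shows "cube_gauge c r a n (cube_push c r a n (x, t)) = (1 - t) * cube_gauge c r a n x + t"
proof -
  have "1 - t + t / cube_gauge c r a n x \<ge> 0"
    using assms by auto
  then have "cube_gauge c r a n (cube_push c r a n (x, t)) = (1 - t + t / cube_gauge c r a n x) * cube_gauge c r a n x"
    unfolding cube_push_def prod.case by (rule cube_gauge_scale)
  with assms(2) show ?thesis
    by (simp add: distrib_right)
qed

lemma cube_push_in_coord_space:
  assumes "a \<in> coord_space n" "x \<in> coord_space n"
  shows "cube_push c r a n (x, t) \<in> coord_space n"
  using assms by (auto simp: coord_space_def cube_push_def)

lemma cube_push_in_closed_cube:
  assumes "a \<in> open_cube n c r" "x \<in> closed_cube n c r" "x \<noteq> a" "t \<in> {0..1}"
  shows "cube_push c r a n (x, t) \<in> closed_cube n c r"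
proof -
  have x: "x \<in> coord_space n" "cube_gauge c r a n x \<le> 1"
    using assms mem_closed_cube_iff_gauge by auto
  then have "(1 - t) * cube_gauge c r a n x \<le> (1 - t) * 1"
    using assms(4) by (intro mult_left_mono) auto
  then show ?thesis
    using x assms cube_push_in_coord_space[of a n x] cube_gauge_pos[OF assms(1) x(1) assms(3)]
    by (auto simp: mem_closed_cube_iff_gauge[OF assms(1)] cube_gauge_push open_cube_def)
qed

lemma cube_push_1_notin_open_cube:
  assumes "a \<in> open_cube n c r" "x \<in> closed_cube n c r" "x \<noteq> a"
  shows "cube_push c r a n (x, 1) \<notin> open_cube n c r"
  using assms cube_gauge_pos[OF assms(1) _ assms(3)]
  by (auto simp: mem_open_cube_iff_gauge[OF assms(1)] mem_closed_cube_iff_gauge[OF assms(1)] cube_gauge_push)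

lemma cube_push_boundary:
  assumes "a \<in> open_cube n c r" "x \<in> closed_cube n c r" "x \<notin> open_cube n c r"
  shows "cube_push c r a n (x, t) = x"
proof -
  have "cube_gauge c r a n x = 1"
    using assms by (auto simp: mem_closed_cube_iff_gauge[OF assms(1)] mem_open_cube_iff_gauge[OF assms(1)])
  then show ?thesis by (simp add: cube_push_def)
qed

lemma continuous_on_cube_push:
  assumes "a \<in> open_cube n c r"
  shows "continuous_on ((closed_cube n c r - {a}) \<times> {0..1}) (cube_push c r a n)"
proof (rule continuous_on_coordinatewise_then_product)
  fix i
  let ?S = "(closed_cube n c r - {a}) \<times> {0..1 :: real}"
  have coord: "continuous_on UNIV (\<lambda>x :: nat \<Rightarrow> real. x i)"
    by (rule continuous_on_product_coordinates)
  have 1: "continuous_on ?S (\<lambda>p. fst p i)"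
    using continuous_on_compose2[OF coord continuous_on_fst[OF continuous_on_id], of ?S] by simp
  have 2: "continuous_on ?S (\<lambda>p. cube_gauge c r a n (fst p))"
    using continuous_on_compose2[OF continuous_on_cube_gauge[of UNIV c r a n]
        continuous_on_fst[OF continuous_on_id], of ?S] by simp
  have 3: "\<forall>p\<in>?S. cube_gauge c r a n (fst p) \<noteq> 0"
  proof
    fix p assume "p \<in> ?S"
    then show "cube_gauge c r a n (fst p) \<noteq> 0"
      using cube_gauge_pos[OF assms, of "fst p"] by (auto simp: closed_cube_def)
  qed
  show "continuous_on ?S (\<lambda>p. cube_push c r a n p i)"
    unfolding cube_push_def case_prod_unfold
    by (intro continuous_intros 1 2) (use 3 in blast)
qed

lemma segment_in_open_cube:
  assumes "x \<in> open_cube n c r" "y \<in> open_cube n c r" "t \<in> {0..1}"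
  shows "(\<lambda>i. (1 - t) * x i + t * y i) \<in> open_cube n c r"
proof -
  have "\<bar>(1 - t) * x i + t * y i - c i\<bar> < r" if "i < n" for i
  proof -
    have "(1 - t) * x i + t * y i - c i \<in> {- r<..<r}"
      using convexD_alt[of "{- r<..<r}" "x i - c i" "y i - c i" t] assms that
      by (auto simp: open_cube_def abs_less_iff algebra_simps)
    then show ?thesis by auto
  qed
  then show ?thesis
    using assms by (auto simp: open_cube_def coord_space_def)
qed

lemma homotopic_paths_open_cube:
  assumes "path p" "path_image p \<subseteq> open_cube n c r" "path q" "path_image q \<subseteq> open_cube n c r"
    and "pathstart p = pathstart q" "pathfinish p = pathfinish q"
  shows "homotopic_paths (open_cube n c r) p q"
  unfolding homotopic_paths
proof (intro exI conjI ballI)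
  let ?h = "\<lambda>(t, s). (\<lambda>i. (1 - t) * p s i + t * q s i)"
  show "continuous_on ({0..1} \<times> {0..1}) ?h"
  proof (rule continuous_on_coordinatewise_then_product)
    fix i
    have *: "continuous_on ({0..1} \<times> {0..1}) (\<lambda>z. g (snd z) i)" if "path g" for g :: "real \<Rightarrow> nat \<Rightarrow> real"
    proof -
      have "continuous_on {0..1} (\<lambda>s. g s i)"
        using that unfolding path_def by (rule continuous_on_product_then_coordinatewise)
      then show ?thesis
        by (rule continuous_on_compose2[OF _ continuous_on_snd[OF continuous_on_id]]) auto
    qed
    show "continuous_on ({0..1} \<times> {0..1}) (\<lambda>z. ?h z i)"
      unfolding case_prod_unfold by (intro continuous_intros * assms)
  qed
  show "?h \<in> {0..1} \<times> {0..1} \<rightarrow> open_cube n c r"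
    using assms(2,4) by (auto simp: path_image_def intro!: segment_in_open_cube)
qed (use assms in \<open>auto simp: pathstart_def pathfinish_def algebra_simps\<close>)

lemma path_connected_open_cube: "path_connected (open_cube n c r)"
  unfolding path_connected_def
proof (intro ballI)
  fix x y assume xy: "x \<in> open_cube n c r" "y \<in> open_cube n c r"
  let ?p = "\<lambda>t i. (1 - t) * x i + t * y i"
  have "path ?p"
    unfolding path_def
    by (rule continuous_on_coordinatewise_then_product) (intro continuous_intros)
  moreover have "path_image ?p \<subseteq> open_cube n c r"
    using xy by (auto simp: path_image_def intro!: segment_in_open_cube)
  moreover have "pathstart ?p = x" "pathfinish ?p = y"
    by (simp_all add: pathstart_def pathfinish_def)
  ultimately show "\<exists>g. path g \<and> path_image g \<subseteq> open_cube n c r \<and> pathstart g = x \<and> pathfinish g = y"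
    by blast
qed

text \<open>The last clause lets a map that misses one point of \<open>B\<close> be pushed off all of \<open>B\<close>.\<close>

definition cell :: "'b::topological_space set \<Rightarrow> 'b set \<Rightarrow> 'b set \<Rightarrow> bool" where
  "cell M B D \<longleftrightarrow>
     openin (top_of_set M) B \<and> B \<subseteq> D \<and> D \<subseteq> M \<and> compact D \<and> path_connected B \<and>
     (\<forall>p q. path p \<and> path_image p \<subseteq> B \<and> path q \<and> path_image q \<subseteq> B \<and>
        pathstart p = pathstart q \<and> pathfinish p = pathfinish q \<longrightarrow> homotopic_paths B p q) \<and>
     (\<forall>a\<in>B. \<exists>R. continuous_on ((M - {a}) \<times> {0..1 :: real}) R \<and> R ` ((M - {a}) \<times> {0..1}) \<subseteq> M \<and>
        (\<forall>y\<in>M. R (y, 0) = y) \<and> (\<forall>y\<in>M - B. \<forall>t\<in>{0..1}. R (y, t) = y) \<and>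
        (\<forall>y\<in>B - {a}. R (y, 1) \<in> D - B))"

text \<open>The retraction is the radial push, conjugated by the chart, on \<open>B\<close> and the
  identity elsewhere. Compactness of \<open>D\<close> together with the Hausdorff property makes
  \<open>D\<close> closed in \<open>M\<close>, which the gluing requires.\<close>

lemma cell_chart:
  fixes M :: "'b::topological_space set"
  assumes haus: "Hausdorff_space (top_of_set M)" and U: "openin (top_of_set M) U"
    and V: "openin (top_of_set (coord_space n)) V"
    and hom: "homeomorphism U V \<phi> \<psi>" and c: "c \<in> V" and sub: "closed_cube n c r \<subseteq> V"
  shows "cell M (\<psi> ` open_cube n c r) (\<psi> ` closed_cube n c r)"
proof -
  define B where "B = \<psi> ` open_cube n c r"
  define D where "D = \<psi> ` closed_cube n c r"
  have subo: "open_cube n c r \<subseteq> V"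
    using sub open_cube_subset_closed_cube by blast
  have UM: "U \<subseteq> M" using U openin_imp_subset by blast
  have DU: "D \<subseteq> U"
    using hom sub by (auto simp: D_def homeomorphism_def)
  have BD: "B \<subseteq> D"
    unfolding B_def D_def by (intro image_mono open_cube_subset_closed_cube)
  have cont\<psi>: "continuous_on V \<psi>" and cont\<phi>: "continuous_on U \<phi>"
    using hom by (auto simp: homeomorphism_def)
  have \<phi>\<psi>: "\<phi> (\<psi> x) = x" if "x \<in> V" for x
    using hom that by (auto simp: homeomorphism_def)
  have \<psi>\<phi>: "\<psi> (\<phi> y) = y" if "y \<in> U" for y
    using hom that by (auto simp: homeomorphism_def)
  have \<phi>D: "\<phi> y \<in> closed_cube n c r" if "y \<in> D" for y
    using that sub \<phi>\<psi> by (auto simp: D_def)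
  have \<phi>B: "\<phi> y \<in> open_cube n c r \<longleftrightarrow> y \<in> B" if "y \<in> D" for y
    using that sub subo \<phi>\<psi> by (force simp: D_def B_def)
  have opB: "openin (top_of_set M) B"
  proof -
    have "openin (top_of_set V) (open_cube n c r)"
      using openin_open_cube subo V by (meson openin_subset_trans openin_imp_subset)
    then have "openin (top_of_set U) B"
      unfolding B_def using hom by (metis homeomorphism_imp_open_map homeomorphism_symD)
    then show ?thesis using U openin_trans by blast
  qed
  have cD: "compact D"
    unfolding D_def using cont\<psi> sub c V
    by (intro compact_continuous_image compact_closed_cube)
       (auto intro: continuous_on_subset dest: openin_imp_subset)
  have clD: "closedin (top_of_set M) D"
    using compactin_imp_closedin[OF haus, of D] cD DU UM by (simp add: compactin_subtopology)
  have pc: "path_connected B"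
    unfolding B_def using cont\<psi> subo path_connected_open_cube
    by (intro path_connected_continuous_image) (auto intro: continuous_on_subset)
  have hp: "homotopic_paths B p q"
    if pq: "path p" "path_image p \<subseteq> B" "path q" "path_image q \<subseteq> B"
      "pathstart p = pathstart q" "pathfinish p = pathfinish q" for p q
  proof -
    have \<phi>B': "continuous_on B \<phi>" "\<phi> ` B \<subseteq> open_cube n c r"
      using cont\<phi> DU BD \<phi>B by (auto intro: continuous_on_subset)
    have *: "path (\<phi> \<circ> g)" "path_image (\<phi> \<circ> g) \<subseteq> open_cube n c r"
      if "path g" "path_image g \<subseteq> B" for g
      using that \<phi>B' by (auto intro!: path_continuous_image continuous_on_subset[OF \<phi>B'(1)]
          simp: path_image_compose)
    have "homotopic_paths (open_cube n c r) (\<phi> \<circ> p) (\<phi> \<circ> q)"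
      using pq * by (intro homotopic_paths_open_cube) (auto simp: pathstart_compose pathfinish_compose)
    then have "homotopic_paths B (\<psi> \<circ> (\<phi> \<circ> p)) (\<psi> \<circ> (\<phi> \<circ> q))"
      by (rule homotopic_paths_continuous_image)
         (use cont\<psi> subo in \<open>auto simp: B_def intro: continuous_on_subset\<close>)
    \<comment> \<open>\<open>\<psi> \<circ> \<phi>\<close> fixes \<open>g\<close> only at parameters
      in \<open>[0, 1]\<close>, since outside them \<open>g\<close> may leave the chart; hence a
      homotopy instead of an equality of functions.\<close>
    moreover have "homotopic_paths B g (\<psi> \<circ> (\<phi> \<circ> g))" if "path g" "path_image g \<subseteq> B" for g
      using that DU BD by (intro homotopic_paths_eq) (auto simp: path_image_def \<psi>\<phi> subset_iff)
    ultimately show ?thesis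
      using pq homotopic_paths_trans homotopic_paths_sym by metis
  qed
  have R: "\<exists>R. continuous_on ((M - {a}) \<times> {0..1 :: real}) R \<and> R ` ((M - {a}) \<times> {0..1}) \<subseteq> M \<and>
        (\<forall>y\<in>M. R (y, 0) = y) \<and> (\<forall>y\<in>M - B. \<forall>t\<in>{0..1}. R (y, t) = y) \<and>
        (\<forall>y\<in>B - {a}. R (y, 1) \<in> D - B)" if a: "a \<in> B" for a
  proof -
    define P where "P = (\<lambda>z. \<psi> (cube_push c r (\<phi> a) n (\<phi> (fst z), snd z)))"
    define R where "R = (\<lambda>z :: 'b \<times> real. if fst z \<in> B then P z else fst z)"
    have a': "\<phi> a \<in> open_cube n c r" using a \<phi>B BD by blast
    have inj: "\<phi> y \<noteq> \<phi> a" if "y \<in> D" "y \<noteq> a" for y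
      using that a \<psi>\<phi> DU BD by (metis subsetD)
    have PD: "P (y, t) \<in> D" if "y \<in> D" "y \<noteq> a" "t \<in> {0..1}" for y t
      using cube_push_in_closed_cube[OF a' \<phi>D[OF that(1)] inj[OF that(1,2)] that(3)]
      by (auto simp: P_def D_def)
    have pushV: "cube_push c r (\<phi> a) n (\<phi> y, t) \<in> V" if "y \<in> D" "y \<noteq> a" "0 \<le> t" "t \<le> 1" for y t
      using cube_push_in_closed_cube[OF a' \<phi>D[OF that(1)] inj[OF that(1,2)], of t] that sub by auto
    have P1: "P (y, 1) \<notin> B" if "y \<in> D" "y \<noteq> a" for y
    proof -
      let ?w = "cube_push c r (\<phi> a) n (\<phi> y, 1)"
      have "?w \<in> closed_cube n c r"
        using cube_push_in_closed_cube[OF a' \<phi>D[OF that(1)] inj[OF that], of 1] by simp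
      moreover have "?w \<notin> open_cube n c r"
        using cube_push_1_notin_open_cube[OF a' \<phi>D[OF that(1)] inj[OF that]] .
      ultimately show ?thesis
        using \<phi>B[of "\<psi> ?w"] \<phi>\<psi>[of ?w] sub by (auto simp: P_def D_def)
    qed
    have Pb: "P (y, t) = y" if "y \<in> D" "y \<notin> B" for y t
      using cube_push_boundary[OF a' \<phi>D[OF that(1)]] \<phi>B[OF that(1)] that(2) \<psi>\<phi> DU that(1)
      by (auto simp: P_def)
    have contP: "continuous_on ((D - {a}) \<times> {0..1}) P"
    proof -
      have "continuous_on ((D - {a}) \<times> {0..1 :: real}) (\<lambda>z. (\<phi> (fst z), snd z))"
        using DU by (intro continuous_on_Pair continuous_on_snd continuous_on_id
            continuous_on_compose2[OF cont\<phi> continuous_on_fst[OF continuous_on_id]]) auto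
      then have "continuous_on ((D - {a}) \<times> {0..1}) (\<lambda>z. cube_push c r (\<phi> a) n (\<phi> (fst z), snd z))"
        by (rule continuous_on_compose2[OF continuous_on_cube_push[OF a']]) (use \<phi>D inj in auto)
      then show ?thesis
        unfolding P_def
        by (rule continuous_on_compose2[OF cont\<psi>])
           (auto intro!: pushV)
    qed
    \<comment> \<open>The two closed pieces overlap over \<open>D - B\<close>, where the push is
      stationary by \<open>Pb\<close>.\<close>
    have "continuous_on ((D - {a}) \<times> {0..1} \<union> (M - B - {a}) \<times> {0..1}) R"
      unfolding R_def
    proof (rule continuous_on_cases_local)
      have eq: "(D - {a}) \<times> {0..1} \<union> (M - B - {a}) \<times> {0..1} = (M - {a}) \<times> {0..1 :: real}"
        using BD DU UM by auto
      have "closedin (top_of_set ((M - {a}) \<times> {0..1 :: real})) ((M - {a}) \<times> {0..1} \<inter> fst -` T)"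
        if "closedin (top_of_set M) T" for T
      proof (rule continuous_closedin_preimage_gen[of _ _ M])
        show "continuous_on ((M - {a}) \<times> {0..1 :: real}) fst"
          by (intro continuous_on_fst continuous_on_id)
      qed (use that in auto)
      note * = this
      have "closedin (top_of_set M) (M - B)"
        using opB by (metis closedin_diff closedin_topspace topspace_euclidean_subtopology)
      note clB = *[OF this]
      have eqs: "(D - {a}) \<times> {0..1 :: real} = (M - {a}) \<times> {0..1} \<inter> fst -` D"
        "(M - B - {a}) \<times> {0..1 :: real} = (M - {a}) \<times> {0..1} \<inter> fst -` (M - B)"
        using DU UM by auto
      show "closedin (top_of_set ((D - {a}) \<times> {0..1} \<union> (M - B - {a}) \<times> {0..1}))
          ((D - {a}) \<times> {0..1 :: real})"
        unfolding eq unfolding eqs(1) by (rule *[OF clD])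
      show "closedin (top_of_set ((D - {a}) \<times> {0..1} \<union> (M - B - {a}) \<times> {0..1}))
          ((M - B - {a}) \<times> {0..1 :: real})"
        unfolding eq unfolding eqs(2) by (rule clB)
      show "continuous_on ((M - B - {a}) \<times> {0..1 :: real}) fst"
        by (intro continuous_on_fst continuous_on_id)
    qed (use contP Pb BD in auto)
    moreover have "(D - {a}) \<times> {0..1} \<union> (M - B - {a}) \<times> {0..1} = (M - {a}) \<times> {0..1 :: real}"
      using BD DU UM by auto
    ultimately have "continuous_on ((M - {a}) \<times> {0..1}) R" by simp
    moreover have "R ` ((M - {a}) \<times> {0..1}) \<subseteq> M"
    proof -
      have PM: "P (y, t) \<in> M" if "y \<in> B" "y \<noteq> a" "0 \<le> t" "t \<le> 1" for y t
        using PD[of y t] that BD DU UM by auto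
      show ?thesis by (auto simp: R_def intro!: PM)
    qed
    moreover have "\<forall>y\<in>M. R (y, 0) = y"
      using BD DU by (auto simp: R_def P_def intro!: \<psi>\<phi>)
    moreover have "\<forall>y\<in>B - {a}. R (y, 1) \<in> D - B"
      using PD P1 BD by (auto simp: R_def)
    ultimately show ?thesis
      by (intro exI[of _ R]) (auto simp: R_def)
  qed
  show ?thesis
    unfolding cell_def B_def[symmetric] D_def[symmetric]
  proof (intro conjI allI impI ballI)
    show "D \<subseteq> M" using DU UM by blast
  qed (use opB BD cD pc hp R in simp_all)
qed

text \<open>The condition \<open>e \<notin> D - B\<close> guarantees that pushing a map out of the
  cell never moves a value to \<open>e\<close>. It is met by choosing between two radii.\<close>

lemma manifold_cell:
  assumes M: "manifold M" and N: "openin (top_of_set M) N" and z: "z \<in> N"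
  obtains B D where "cell M B D" "z \<in> B" "D \<subseteq> N" "e \<notin> D - B"
proof -
  have haus: "Hausdorff_space (top_of_set M)"
    using M by (simp add: manifold_def)
  have "z \<in> M" using N z openin_imp_subset by blast
  then obtain n U V where U: "openin (top_of_set M) U" "z \<in> U" "openin (top_of_set (coord_space n)) V"
    and UV: "top_of_set U homeomorphic_space subtopology (top_of_set (coord_space n)) V"
    using M unfolding manifold_def Euclidean_space_eq_coord_space by metis
  have "subtopology (top_of_set (coord_space n)) V = top_of_set V"
    using U(3) openin_imp_subset[OF U(3)] by (simp add: subtopology_subtopology inf_absorb2)
  with UV obtain \<phi> \<psi> where "homeomorphic_maps (top_of_set U) (top_of_set V) \<phi> \<psi>"
    by (auto simp: homeomorphic_space_def)
  then have hom: "homeomorphism U V \<phi> \<psi>"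
    by (simp add: homeomorphic_maps_def homeomorphism_def) (metis (no_types) image_subset_iff_funcset
        subset_antisym image_subset_iff subsetI image_eqI)
  have \<phi>z: "\<phi> z \<in> V" "\<psi> (\<phi> z) = z" using hom U(2) by (auto simp: homeomorphism_def)
  have "openin (top_of_set V) (V \<inter> \<psi> -` (N \<inter> U))"
  proof (rule continuous_openin_preimage[of _ _ U])
    show "openin (top_of_set U) (N \<inter> U)"
      using N by (meson U(1) openin_Int openin_imp_subset openin_subset_trans inf_le2)
  qed (use hom in \<open>auto simp: homeomorphism_def\<close>)
  then have "openin (top_of_set (coord_space n)) (V \<inter> \<psi> -` (N \<inter> U))"
    using U(3) openin_trans by blast
  moreover have "\<phi> z \<in> V \<inter> \<psi> -` (N \<inter> U)" using \<phi>z U z by auto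
  ultimately obtain r where r: "r > 0" "closed_cube n (\<phi> z) r \<subseteq> V \<inter> \<psi> -` (N \<inter> U)"
    using closed_cube_in_open by metis
  have rec: "cell M (\<psi> ` open_cube n (\<phi> z) s) (\<psi> ` closed_cube n (\<phi> z) s)
      \<and> z \<in> \<psi> ` open_cube n (\<phi> z) s \<and> \<psi> ` closed_cube n (\<phi> z) s \<subseteq> N" if s: "0 < s" "s \<le> r" for s
  proof (intro conjI)
    have ss: "closed_cube n (\<phi> z) s \<subseteq> closed_cube n (\<phi> z) r"
      using s by (auto simp: closed_cube_def)
    show "cell M (\<psi> ` open_cube n (\<phi> z) s) (\<psi> ` closed_cube n (\<phi> z) s)"
      using ss r(2) by (intro cell_chart[OF haus U(1,3) hom \<phi>z(1)]) auto
    have "\<phi> z \<in> open_cube n (\<phi> z) s"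
      using s \<phi>z(1) openin_imp_subset[OF U(3)] by (auto simp: open_cube_def)
    then show "z \<in> \<psi> ` open_cube n (\<phi> z) s" using \<phi>z(2) by (metis imageI)
    show "\<psi> ` closed_cube n (\<phi> z) s \<subseteq> N" using ss r(2) by auto
  qed
  \<comment> \<open>If \<open>e\<close> lies in the closed cell of radius \<open>r / 2\<close>, it
    is inside the open cell of radius \<open>r\<close>; otherwise the closed cell of radius
    \<open>r / 2\<close> misses it altogether.\<close>
  show ?thesis
  proof (cases "e \<in> \<psi> ` closed_cube n (\<phi> z) (r / 2)")
    case True
    have "closed_cube n (\<phi> z) (r / 2) \<subseteq> open_cube n (\<phi> z) r"
      using r(1) by (fastforce simp: closed_cube_def open_cube_def)
    with True rec[of r] r(1) that show ?thesis by blast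
  next
    case False
    with rec[of "r / 2"] r(1) that show ?thesis by auto
  qed
qed

subsection \<open>Pushing lifts off points of the fibre\<close>

lemma homotopic_paths_convex:
  fixes S :: "'v::real_normed_vector set"
  assumes "convex S" "path p" "path_image p \<subseteq> S" "path q" "path_image q \<subseteq> S"
    and "pathstart p = pathstart q" "pathfinish p = pathfinish q"
  shows "homotopic_paths S p q"
proof (rule homotopic_paths_linear)
  fix t :: real assume "t \<in> {0..1}"
  then have "p t \<in> S" "q t \<in> S"
    using assms by (auto simp: path_image_def)
  then show "closed_segment (p t) (q t) \<subseteq> S"
    by (rule closed_segment_subset[OF _ _ assms(1)])
qed (use assms in auto)

lemma path_const [simp]:
  "path (\<lambda>_. x)" "path_image (\<lambda>_. x) = {x}" "pathstart (\<lambda>_. x) = x" "pathfinish (\<lambda>_. x) = x"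
  by (auto simp: path_def path_image_def pathstart_def pathfinish_def)

text \<open>The library versions \<open>homotopic_paths_rid\<close> of this use \<^const>\<open>linepath\<close> and so need a vector space.\<close>

lemma homotopic_paths_rid_const:
  assumes "path p" "path_image p \<subseteq> S" "x = pathfinish p"
  shows "homotopic_paths S (p +++ (\<lambda>_. x)) p"
proof -
  have 1: "continuous_on {0..1} (\<lambda>t::real. if t \<le> 1/2 then 2 *\<^sub>R t else 1)"
    unfolding split_01 by (rule continuous_on_cases continuous_intros | force)+
  show ?thesis
    apply (rule homotopic_paths_sym)
    using assms 1 unfolding pathfinish_def joinpaths_def
    by (intro homotopic_paths_reparametrize [where f = "\<lambda>t. if t \<le> 1/2 then 2 *\<^sub>R t else 1"]) force+
qed

text \<open>All the paths are images, under \<open>(s, t) \<mapsto> K (q s, t)\<close>, of edges and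
  the diagonal of the unit square, and in a convex set paths with common ends are homotopic. The
  first part transports lifts across a homotopy; the second one matches the diagonal paths in
  \<open>related_classes\<close>.\<close>

lemma homotopic_paths_across_homotopy:
  fixes K :: "'a::topological_space \<times> real \<Rightarrow> 'b::topological_space"
  assumes K: "continuous_on (X \<times> {0..1}) K" "K ` (X \<times> {0..1}) \<subseteq> M"
    and q: "path q" "path_image q \<subseteq> X"
  shows "homotopic_paths M ((\<lambda>t. K (pathstart q, t)) +++ (\<lambda>t. K (q t, 1)))
           ((\<lambda>t. K (q t, 0)) +++ (\<lambda>t. K (pathfinish q, t)))" (is ?edges)
    and "homotopic_paths M (\<lambda>t. K (q t, t))
           ((\<lambda>t. K (q t, 0)) +++ (\<lambda>t. K (pathfinish q, t)))" (is ?diagonal)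
proof -
  define S where "S = {0..1 :: real} \<times> {0..1 :: real}"
  define Q where "Q = (\<lambda>z :: real \<times> real. K (q (fst z), snd z))"
  have conv: "convex S"
    unfolding S_def by (intro convex_Times) auto
  have "continuous_on S (\<lambda>z. (q (fst z), snd z))"
    using q unfolding S_def path_def
    by (intro continuous_on_Pair continuous_on_snd continuous_on_id
        continuous_on_compose2[OF _ continuous_on_fst[OF continuous_on_id]]) auto
  then have contQ: "continuous_on S Q"
    unfolding Q_def by (rule continuous_on_compose2[OF K(1)]) (use q in \<open>auto simp: S_def path_image_def\<close>)
  have QM: "Q \<in> S \<rightarrow> M"
    using q by (auto simp: Q_def S_def path_image_def intro!: K(2)[unfolded image_subset_iff, rule_format])
  have hom: "homotopic_paths M (Q \<circ> u) (Q \<circ> v)"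
    if "path u" "path_image u \<subseteq> S" "path v" "path_image v \<subseteq> S"
      "pathstart u = pathstart v" "pathfinish u = pathfinish v" for u v
    using homotopic_paths_continuous_image[OF homotopic_paths_convex[OF conv that] contQ QM] .
  have seg: "path_image (linepath a b) \<subseteq> S" if "a \<in> S" "b \<in> S" for a b
    using closed_segment_subset[OF that conv] by simp
  let ?left = "linepath (0, 0) (0, 1 :: real) :: real \<Rightarrow> real \<times> real"
    and ?top = "linepath (0, 1) (1, 1 :: real) :: real \<Rightarrow> real \<times> real"
    and ?bot = "linepath (0, 0) (1, 0 :: real) :: real \<Rightarrow> real \<times> real"
    and ?right = "linepath (1, 0) (1, 1 :: real) :: real \<Rightarrow> real \<times> real"
    and ?diag = "linepath (0, 0) (1, 1 :: real) :: real \<Rightarrow> real \<times> real"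
  have in_S: "(0, 0) \<in> S" "(0, 1) \<in> S" "(1, 0) \<in> S" "(1, 1) \<in> S"
    by (auto simp: S_def)
  have eqs: "Q \<circ> ?left = (\<lambda>t. K (pathstart q, t))" "Q \<circ> ?top = (\<lambda>t. K (q t, 1))"
    "Q \<circ> ?bot = (\<lambda>t. K (q t, 0))" "Q \<circ> ?right = (\<lambda>t. K (pathfinish q, t))"
    "Q \<circ> ?diag = (\<lambda>t. K (q t, t))"
    by (auto simp: Q_def linepath_def pathstart_def pathfinish_def fun_eq_iff)
  have "homotopic_paths M (Q \<circ> (?left +++ ?top)) (Q \<circ> (?bot +++ ?right))"
    by (rule hom) (intro subset_path_image_join seg in_S | simp)+
  then show ?edges by (simp only: path_compose_join eqs)
  have "homotopic_paths M (Q \<circ> ?diag) (Q \<circ> (?bot +++ ?right))"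
    by (rule hom) (intro subset_path_image_join seg in_S | simp)+
  then show ?diagonal by (simp only: path_compose_join eqs)
qed

text \<open>Homotopies here carry time in the second component, as in \<open>homotopy_from\<close>,
  whereas \<open>homotopic_with\<close> puts it first; this lemma and the next one
  translate.\<close>

lemma homotopic_with_canon_homotopy:
  assumes "continuous_on (X \<times> {0..1}) K" "K ` (X \<times> {0..1}) \<subseteq> M"
    and "\<And>x. x \<in> X \<Longrightarrow> K (x, 0) = k x" "\<And>x. x \<in> X \<Longrightarrow> K (x, 1 :: real) = k' x"
  shows "homotopic_with_canon (\<lambda>_. True) X M k k'"
proof -
  have "continuous_on ({0..1} \<times> X) (\<lambda>z. K (snd z, fst z))"
    by (rule continuous_on_compose2[OF assms(1)]) (auto intro!: continuous_intros)
  then have "homotopic_with_canon (\<lambda>_. True) X M (\<lambda>x. K (x, 0)) (\<lambda>x. K (x, 1))"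
    unfolding homotopic_with_def using assms(2)
    by (intro exI[of _ "\<lambda>z. K (snd z, fst z)"]) (auto simp: image_subset_iff)
  then show ?thesis
    by (rule homotopic_with_eq) (use assms(3,4) in auto)
qed

lemma homotopic_with_canon_imp_homotopy:
  assumes "homotopic_with_canon (\<lambda>_. True) X M k k'"
  obtains K where "continuous_on (X \<times> {0..1 :: real}) K" "K ` (X \<times> {0..1}) \<subseteq> M"
    "\<And>x. K (x, 0) = k x" "\<And>x. K (x, 1) = k' x"
proof -
  obtain h where h: "continuous_on ({0..1 :: real} \<times> X) h" "h ` ({0..1} \<times> X) \<subseteq> M"
    "\<And>x. h (0, x) = k x" "\<And>x. h (1, x) = k' x"
    using assms by (auto simp: homotopic_with_def image_subset_iff)
  have "continuous_on (X \<times> {0..1}) (\<lambda>z. h (snd z, fst z))"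
    by (rule continuous_on_compose2[OF h(1)]) (auto intro!: continuous_intros)
  then show ?thesis
    using h by (intro that[of "\<lambda>z. h (snd z, fst z)"]) auto
qed

text \<open>A lift of \<open>k : X \<rightarrow> M\<close> to a covering space of \<open>M\<close>, described without constructing the
  covering: \<open>L x \<beta>\<close> says that the lifted point over \<open>k x\<close> is represented by the path \<open>\<beta>\<close>
  from the base point \<open>e\<close> to \<open>k x\<close>.\<close>

definition lift_system ::
    "'a::topological_space set \<Rightarrow> 'b::topological_space set \<Rightarrow> 'b \<Rightarrow> ('a \<Rightarrow> 'b) \<Rightarrow>
      ('a \<Rightarrow> (real \<Rightarrow> 'b) \<Rightarrow> bool) \<Rightarrow> bool" where
  "lift_system X M e k L \<longleftrightarrow> continuous_on X k \<and> k ` X \<subseteq> M \<and>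
     (\<forall>x \<beta>. L x \<beta> \<longrightarrow> x \<in> X \<and> path \<beta> \<and> path_image \<beta> \<subseteq> M \<and> pathstart \<beta> = e \<and> pathfinish \<beta> = k x) \<and>
     (\<forall>x \<beta> \<beta>'. L x \<beta> \<and> homotopic_paths M \<beta> \<beta>' \<longrightarrow> L x \<beta>') \<and>
     (\<forall>x \<beta> q. L x \<beta> \<and> path q \<and> path_image q \<subseteq> X \<and> pathstart q = x \<longrightarrow>
        L (pathfinish q) (\<beta> +++ (k \<circ> q)))"

lemma lift_systemD:
  assumes "lift_system X M e k L"
  shows "continuous_on X k" "k ` X \<subseteq> M"
    and "L x \<beta> \<Longrightarrow> x \<in> X" "L x \<beta> \<Longrightarrow> path \<beta>" "L x \<beta> \<Longrightarrow> path_image \<beta> \<subseteq> M"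
      "L x \<beta> \<Longrightarrow> pathstart \<beta> = e" "L x \<beta> \<Longrightarrow> pathfinish \<beta> = k x"
    and "L x \<beta> \<Longrightarrow> homotopic_paths M \<beta> \<beta>' \<Longrightarrow> L x \<beta>'"
    and "L x \<beta> \<Longrightarrow> path q \<Longrightarrow> path_image q \<subseteq> X \<Longrightarrow> pathstart q = x \<Longrightarrow>
      L (pathfinish q) (\<beta> +++ (k \<circ> q))"
proof -
  note sys = assms[unfolded lift_system_def]
  note ends = sys[THEN conjunct2, THEN conjunct2, THEN conjunct1]
    and hom = sys[THEN conjunct2, THEN conjunct2, THEN conjunct2, THEN conjunct1]
    and transport = sys[THEN conjunct2, THEN conjunct2, THEN conjunct2, THEN conjunct2]
  show "continuous_on X k" "k ` X \<subseteq> M"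
    by (rule sys[THEN conjunct1] sys[THEN conjunct2, THEN conjunct1])+
  show "L x \<beta> \<Longrightarrow> x \<in> X" "L x \<beta> \<Longrightarrow> path \<beta>" "L x \<beta> \<Longrightarrow> path_image \<beta> \<subseteq> M"
      "L x \<beta> \<Longrightarrow> pathstart \<beta> = e" "L x \<beta> \<Longrightarrow> pathfinish \<beta> = k x"
    using ends by blast+
  show "L x \<beta> \<Longrightarrow> homotopic_paths M \<beta> \<beta>' \<Longrightarrow> L x \<beta>'"
    using hom by blast
  show "L x \<beta> \<Longrightarrow> path q \<Longrightarrow> path_image q \<subseteq> X \<Longrightarrow> pathstart q = x \<Longrightarrow>
      L (pathfinish q) (\<beta> +++ (k \<circ> q))"
    using transport by blast
qed

text \<open>This is the time-1 map of the homotopy \<open>K\<close> lifted from the given lift: the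
  new point is reached by the old path followed by the track of \<open>x\<close>. Closing under path
  homotopy makes it depend on a point of the covering and not on a chosen path.\<close>

definition lift_along ::
    "'b::topological_space set \<Rightarrow> ('a \<times> real \<Rightarrow> 'b) \<Rightarrow> ('a \<Rightarrow> (real \<Rightarrow> 'b) \<Rightarrow> bool) \<Rightarrow>
      'a \<Rightarrow> (real \<Rightarrow> 'b) \<Rightarrow> bool" where
  "lift_along M K L x \<beta>' \<longleftrightarrow> (\<exists>\<beta>. L x \<beta> \<and> homotopic_paths M (\<beta> +++ (\<lambda>t. K (x, t))) \<beta>')"

text \<open>The substance is compatibility with paths \<open>q\<close> in \<open>X\<close>. By the
  square over \<open>q\<close>, the track at the start followed by the time-1 image of
  \<open>q\<close> is homotopic to the time-0 image of \<open>q\<close> followed by the track at the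
  end; the rest is reassociation.\<close>

lemma lift_system_lift_along:
  assumes L: "lift_system X M e k L"
    and K: "continuous_on (X \<times> {0..1}) K" "K ` (X \<times> {0..1}) \<subseteq> M" "\<And>x. x \<in> X \<Longrightarrow> K (x, 0) = k x"
  shows "lift_system X M e (\<lambda>x. K (x, 1)) (lift_along M K L)"
proof -
  note LD = lift_systemD[OF L]
  have c1: "continuous_on X (\<lambda>x. K (x, 1))"
    by (rule continuous_on_compose2[OF K(1)]) (auto intro!: continuous_intros)
  have Kp: "path (\<lambda>t. K (x, t))" "path_image (\<lambda>t. K (x, t)) \<subseteq> M"
    "pathstart (\<lambda>t. K (x, t)) = k x" "pathfinish (\<lambda>t. K (x, t)) = K (x, 1)" if "x \<in> X" for x
  proof -
    show "path (\<lambda>t. K (x, t))"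
      unfolding path_def by (rule continuous_on_compose2[OF K(1)]) (use that in \<open>auto intro!: continuous_intros\<close>)
    show "path_image (\<lambda>t. K (x, t)) \<subseteq> M"
      using K(2) that by (auto simp: path_image_def)
  qed (use K(3) that in \<open>auto simp: pathstart_def pathfinish_def\<close>)
  have ends: "x \<in> X \<and> path \<beta>' \<and> path_image \<beta>' \<subseteq> M \<and> pathstart \<beta>' = e \<and> pathfinish \<beta>' = K (x, 1)"
    if "lift_along M K L x \<beta>'" for x \<beta>'
  proof -
    obtain \<beta> where \<beta>: "L x \<beta>" "homotopic_paths M (\<beta> +++ (\<lambda>t. K (x, t))) \<beta>'"
      using \<open>lift_along M K L x \<beta>'\<close> by (auto simp: lift_along_def)
    note x = LD(3)[OF \<beta>(1)]
    show ?thesis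
      using homotopic_paths_imp_path[OF \<beta>(2)] homotopic_paths_imp_subset[OF \<beta>(2)]
        homotopic_paths_imp_pathstart[OF \<beta>(2)] homotopic_paths_imp_pathfinish[OF \<beta>(2)]
        LD(6)[OF \<beta>(1)] Kp[OF x] x by simp
  qed
  have transport: "lift_along M K L (pathfinish q) (\<beta>' +++ ((\<lambda>x. K (x, 1)) \<circ> q))"
    if L': "lift_along M K L x \<beta>'" and q: "path q" "path_image q \<subseteq> X" "pathstart q = x" for x \<beta>' q
  proof -
    obtain \<beta> where \<beta>: "L x \<beta>" "homotopic_paths M (\<beta> +++ (\<lambda>t. K (x, t))) \<beta>'"
      using L' by (auto simp: lift_along_def)
    note x = LD(3)[OF \<beta>(1)]
    have y: "pathfinish q \<in> X" using q by (meson pathfinish_in_path_image subsetD)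
    have K1q: "path ((\<lambda>x. K (x, 1)) \<circ> q)" "path_image ((\<lambda>x. K (x, 1)) \<circ> q) \<subseteq> M"
      "pathstart ((\<lambda>x. K (x, 1)) \<circ> q) = K (x, 1)"
      using q by (auto intro!: path_continuous_image continuous_on_subset[OF c1]
          K(2)[unfolded image_subset_iff, rule_format] simp: path_image_compose pathstart_compose)
    have kq: "path (k \<circ> q)" "path_image (k \<circ> q) \<subseteq> M" "pathstart (k \<circ> q) = k x"
        "pathfinish (k \<circ> q) = k (pathfinish q)"
      using q LD(1,2) by (auto intro!: path_continuous_image continuous_on_subset[OF LD(1)]
          simp: path_image_compose pathstart_compose pathfinish_compose)
    note \<beta>p = LD(4-7)[OF \<beta>(1)]
    have kq': "homotopic_paths M (\<lambda>t. K (q t, 0)) (k \<circ> q)"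
      using kq q by (intro homotopic_paths_sym[OF homotopic_paths_eq]) (auto simp: path_image_def subset_iff K(3))
    have "homotopic_paths M ((k \<circ> q) +++ (\<lambda>t. K (pathfinish q, t)))
            ((\<lambda>t. K (q t, 0)) +++ (\<lambda>t. K (pathfinish q, t)))"
      by (intro homotopic_paths_join homotopic_paths_sym[OF kq']) (use Kp[OF y] kq in auto)
    also have "homotopic_paths M \<dots> ((\<lambda>t. K (x, t)) +++ (\<lambda>t. K (q t, 1)))"
      using homotopic_paths_sym[OF homotopic_paths_across_homotopy(1)[OF K(1,2) q(1,2)]] q(3) by simp
    finally have sq: "homotopic_paths M ((k \<circ> q) +++ (\<lambda>t. K (pathfinish q, t)))
        ((\<lambda>t. K (x, t)) +++ ((\<lambda>x. K (x, 1)) \<circ> q))"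
      by (simp add: comp_def)
    have "homotopic_paths M ((\<beta> +++ (k \<circ> q)) +++ (\<lambda>t. K (pathfinish q, t)))
            (\<beta> +++ ((k \<circ> q) +++ (\<lambda>t. K (pathfinish q, t))))"
      by (rule homotopic_paths_sym[OF homotopic_paths_assoc]) (use \<beta>p kq Kp[OF y] in auto)
    also have "homotopic_paths M \<dots> (\<beta> +++ ((\<lambda>t. K (x, t)) +++ ((\<lambda>x. K (x, 1)) \<circ> q)))"
      by (rule homotopic_paths_join[OF _ sq]) (use \<beta>p kq in auto)
    also have "homotopic_paths M \<dots> ((\<beta> +++ (\<lambda>t. K (x, t))) +++ ((\<lambda>x. K (x, 1)) \<circ> q))"
      by (rule homotopic_paths_assoc) (use \<beta>p Kp[OF x] K1q in auto)
    also have "homotopic_paths M \<dots> (\<beta>' +++ ((\<lambda>x. K (x, 1)) \<circ> q))"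
      by (rule homotopic_paths_join[OF \<beta>(2)]) (use K1q Kp[OF x] in auto)
    finally show ?thesis
      using LD(9)[OF \<beta>(1) q] by (auto simp: lift_along_def)
  qed
  have closed: "lift_along M K L x \<beta>''" if "lift_along M K L x \<beta>'" "homotopic_paths M \<beta>' \<beta>''" for x \<beta>' \<beta>''
    using that homotopic_paths_trans unfolding lift_along_def by blast
  show ?thesis
    unfolding lift_system_def
  proof (intro conjI)
    show "(\<lambda>x. K (x, 1)) ` X \<subseteq> M" using K(2) by auto
  qed (use c1 ends closed transport in blast)+
qed

text \<open>A stationary point keeps its lift, because a constant path at the end is absorbed up to
  homotopy.\<close>

lemma lift_along_const:
  assumes L: "lift_system X M e k L" and K: "\<And>t. K (x, t) = k x"
  shows "lift_along M K L x \<delta> \<longleftrightarrow> L x \<delta>"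
proof -
  have eq: "(\<lambda>t. K (x, t)) = (\<lambda>_. k x)"
    using K by auto
  have *: "homotopic_paths M (\<beta> +++ (\<lambda>_. k x)) \<beta>" if "L x \<beta>" for \<beta>
    by (rule homotopic_paths_rid_const) (use lift_systemD(4,5,7)[OF L that] in auto)
  show ?thesis
    unfolding lift_along_def eq using * lift_systemD(8)[OF L] homotopic_paths_sym homotopic_paths_trans
    by (metis (no_types, lifting))
qed

text \<open>The last clause says that surviving roots are old ones with their old lifts. Hence the
  set of points over \<open>e\<close> hit by the lift can only shrink, which lets successive pushes
  be composed without undoing one another.\<close>

definition lift_reduction ::
    "'a::topological_space set \<Rightarrow> 'b::topological_space set \<Rightarrow> 'b \<Rightarrow> ('a \<Rightarrow> 'b) \<Rightarrow>
      ('a \<Rightarrow> (real \<Rightarrow> 'b) \<Rightarrow> bool) \<Rightarrow> ('a \<Rightarrow> 'b) \<Rightarrow> ('a \<Rightarrow> (real \<Rightarrow> 'b) \<Rightarrow> bool) \<Rightarrow> bool" where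
  "lift_reduction X M e k L k' L' \<longleftrightarrow> lift_system X M e k' L' \<and>
     homotopic_with_canon (\<lambda>_. True) X M k k' \<and>
     (\<forall>x\<in>X. k' x = e \<longrightarrow> k x = e \<and> (\<forall>\<delta>. L' x \<delta> \<longleftrightarrow> L x \<delta>))"

lemma lift_reduction_refl:
  assumes "lift_system X M e k L"
  shows "lift_reduction X M e k L k L"
  using assms lift_systemD(1,2)[OF assms] by (auto simp: lift_reduction_def image_subset_iff)

lemma lift_reduction_trans:
  assumes "lift_reduction X M e k L k' L'" "lift_reduction X M e k' L' k'' L''"
  shows "lift_reduction X M e k L k'' L''"
  using assms homotopic_with_trans unfolding lift_reduction_def by metis

text \<open>A lift represented by a path ending at \<open>e\<close> sits at a root, so the root
  clause of \<open>lift_reduction\<close> applies. For other end points this persistence may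
  fail.\<close>

lemma lift_reduction_avoids_loop:
  assumes "lift_reduction X M e k L k' L'" "\<And>x. \<not> L x \<delta>" "pathfinish \<delta> = e"
  shows "\<not> L' x \<delta>"
  using assms lift_systemD(3,7) unfolding lift_reduction_def by metis

text \<open>Paths in the cell \<open>B\<close> are determined up to homotopy by their ends, so
  \<open>B\<close> is evenly covered. The path \<open>\<beta>\<close> selects one sheet, and the
  lift misses the point of that sheet over \<open>a\<close>. Only the part of \<open>X\<close> whose
  lift lies in this sheet is pushed radially away from \<open>a\<close>; other sheets over the same
  cell are left alone.\<close>

lemma lift_reduction_expand:
  assumes L: "lift_system X M e k L" and X: "locally path_connected X"
    and cell: "cell M B D" and e: "e \<notin> D - B"
    and \<beta>: "path \<beta>" "path_image \<beta> \<subseteq> M" "pathfinish \<beta> = a" "a \<in> B"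
    and avoid: "\<And>x. \<not> L x \<beta>"
  obtains k' L' where "lift_reduction X M e k L k' L'"
    "\<And>u x. path u \<Longrightarrow> path_image u \<subseteq> B \<Longrightarrow> pathstart u = a \<Longrightarrow> \<not> L' x (\<beta> +++ u)"
proof -
  note LD = lift_systemD[OF L]
  have opB: "openin (top_of_set M) B" and BM: "B \<subseteq> M"
    and hp: "\<And>p q. path p \<Longrightarrow> path_image p \<subseteq> B \<Longrightarrow> path q \<Longrightarrow> path_image q \<subseteq> B \<Longrightarrow>
        pathstart p = pathstart q \<Longrightarrow> pathfinish p = pathfinish q \<Longrightarrow> homotopic_paths B p q"
    using cell unfolding cell_def by auto
  obtain R where R: "continuous_on ((M - {a}) \<times> {0..1 :: real}) R" "R ` ((M - {a}) \<times> {0..1}) \<subseteq> M"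
    "\<And>y. y \<in> M \<Longrightarrow> R (y, 0) = y" "\<And>y t. y \<in> M - B \<Longrightarrow> t \<in> {0..1} \<Longrightarrow> R (y, t) = y"
    "\<And>y. y \<in> B - {a} \<Longrightarrow> R (y, 1) \<in> D - B"
    using cell \<beta>(4) unfolding cell_def by metis
  define N where "N = {x \<in> X. k x \<in> B}"
  \<comment> \<open>The points of \<open>X\<close> lifted into the sheet over \<open>B\<close>
    selected by \<open>\<beta>\<close>; \<open>N\<close> collects all sheets.\<close>
  define W where "W = {x \<in> N. \<exists>u. path u \<and> path_image u \<subseteq> B \<and> pathstart u = a \<and> L x (\<beta> +++ u)}"
  have WN: "W \<subseteq> N" and NX: "N \<subseteq> X" by (auto simp: W_def N_def)
  have opN: "openin (top_of_set X) N"
  proof -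
    have "N = X \<inter> k -` B" by (auto simp: N_def)
    then show ?thesis
      using continuous_openin_preimage[OF LD(1) _ opB] LD(2) by auto
  qed
  \<comment> \<open>A path \<open>u\<close> in \<open>B\<close> that returns to \<open>a\<close> is
    null-homotopic, so a value \<open>a\<close> on \<open>W\<close> would mean that the lift hits
    the point represented by \<open>\<beta>\<close>.\<close>
  have aW: "k x \<noteq> a" if "x \<in> W" for x
  proof
    assume ka: "k x = a"
    obtain u where u: "path u" "path_image u \<subseteq> B" "pathstart u = a" "L x (\<beta> +++ u)"
      using \<open>x \<in> W\<close> by (auto simp: W_def)
    have "pathfinish u = a" using LD(7)[OF u(4)] ka by simp
    then have "homotopic_paths M u (\<lambda>_. a)"
      using u \<beta>(4) by (intro homotopic_paths_subset[OF hp BM]) auto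
    then have "homotopic_paths M (\<beta> +++ u) (\<beta> +++ (\<lambda>_. a))"
      using \<beta> u by (intro homotopic_paths_join) auto
    also have "homotopic_paths M \<dots> \<beta>"
      using \<beta> by (intro homotopic_paths_rid_const) auto
    finally show False
      using LD(8)[OF u(4)] avoid by blast
  qed
  \<comment> \<open>Along a path that \<open>k\<close> maps into \<open>B\<close> the sheet does not
    change. With local path connectedness this makes both \<open>W\<close> and \<open>N - W\<close>
    open.\<close>
  have move: "y' \<in> W" if V: "path_connected V" "V \<subseteq> N" and y: "y \<in> V" "y' \<in> V" "y \<in> W" for V y y'
  proof -
    obtain q where q: "path q" "path_image q \<subseteq> V" "pathstart q = y" "pathfinish q = y'"
      using V y unfolding path_connected_def by blast
    obtain u where u: "path u" "path_image u \<subseteq> B" "pathstart u = a" "L y (\<beta> +++ u)"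
      using y by (auto simp: W_def)
    have fu: "pathfinish u = k y" using LD(7)[OF u(4)] by simp
    have qX: "path_image q \<subseteq> X" using q V NX by blast
    have kq: "path (k \<circ> q)" "path_image (k \<circ> q) \<subseteq> B" "pathstart (k \<circ> q) = k y"
      using q V by (auto intro!: path_continuous_image continuous_on_subset[OF LD(1)]
          simp: path_image_compose pathstart_compose N_def)
    have "L y' ((\<beta> +++ u) +++ (k \<circ> q))"
      using LD(9)[OF u(4) q(1) qX q(3)] q(4) by simp
    moreover have "homotopic_paths M ((\<beta> +++ u) +++ (k \<circ> q)) (\<beta> +++ (u +++ (k \<circ> q)))"
      by (rule homotopic_paths_sym[OF homotopic_paths_assoc]) (use \<beta> u kq BM fu in auto)
    ultimately have "L y' (\<beta> +++ (u +++ (k \<circ> q)))"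
      by (rule LD(8))
    moreover have "path (u +++ (k \<circ> q))" "path_image (u +++ (k \<circ> q)) \<subseteq> B" "pathstart (u +++ (k \<circ> q)) = a"
      using u kq fu by (simp_all add: subset_path_image_join)
    ultimately show ?thesis
      using y V unfolding W_def by blast
  qed
  have nbhd: "\<exists>V. openin (top_of_set X) V \<and> path_connected V \<and> x \<in> V \<and> V \<subseteq> N" if "x \<in> N" for x
    using X opN that unfolding locally_path_connected by blast
  have opW: "openin (top_of_set X) W"
  proof (subst openin_subopen, intro ballI)
    fix x assume "x \<in> W"
    with nbhd[of x] WN obtain V where V: "openin (top_of_set X) V" "path_connected V" "x \<in> V" "V \<subseteq> N"
      by auto
    with move[of V x] \<open>x \<in> W\<close> show "\<exists>T. openin (top_of_set X) T \<and> x \<in> T \<and> T \<subseteq> W" by blast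
  qed
  have opNW: "openin (top_of_set X) (N - W)"
  proof (subst openin_subopen, intro ballI)
    fix x assume x: "x \<in> N - W"
    with nbhd[of x] obtain V where V: "openin (top_of_set X) V" "path_connected V" "x \<in> V" "V \<subseteq> N"
      by auto
    with move[of V _ x] x show "\<exists>T. openin (top_of_set X) T \<and> x \<in> T \<and> T \<subseteq> N - W" by blast
  qed
  define K where "K = (\<lambda>z :: 'a \<times> real. if fst z \<in> W then R (k (fst z), snd z) else k (fst z))"
  have kfst: "continuous_on (A \<times> {0..1 :: real}) (\<lambda>z. k (fst z))" if "A \<subseteq> X" for A
    by (rule continuous_on_compose2[OF LD(1) continuous_on_fst[OF continuous_on_id]]) (use that in auto)
  have contK: "continuous_on (X \<times> {0..1}) K"
  proof -
    \<comment> \<open>Closed sets covering \<open>X\<close> and meeting exactly in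
      \<open>X - N\<close>, where \<open>k\<close> takes values outside \<open>B\<close> and the
      push is stationary.\<close>
    let ?A1 = "X - (N - W)" and ?A2 = "X - W"
    have eq: "?A1 \<times> {0..1} \<union> ?A2 \<times> {0..1} = X \<times> {0..1 :: real}"
      using WN by auto
    have cl: "closedin (top_of_set X) ?A1" "closedin (top_of_set X) ?A2"
      using opW opNW by (metis closedin_diff closedin_topspace topspace_euclidean_subtopology)+
    have kA1: "k x \<in> M - {a}" if "x \<in> ?A1" for x
      using that aW LD(2) \<beta>(4) by (auto simp: N_def)
    have "continuous_on (?A1 \<times> {0..1} \<union> ?A2 \<times> {0..1}) K"
      unfolding K_def
    proof (rule continuous_on_cases_local)
      show "closedin (top_of_set (?A1 \<times> {0..1} \<union> ?A2 \<times> {0..1})) (?A1 \<times> {0..1 :: real})"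
        "closedin (top_of_set (?A1 \<times> {0..1} \<union> ?A2 \<times> {0..1})) (?A2 \<times> {0..1 :: real})"
        unfolding eq by (intro closedin_Times cl; simp)+
      show "continuous_on (?A1 \<times> {0..1}) (\<lambda>z. R (k (fst z), snd z))"
      proof (rule continuous_on_compose2[OF R(1)])
        show "continuous_on (?A1 \<times> {0..1 :: real}) (\<lambda>z. (k (fst z), snd z))"
          by (intro continuous_on_Pair kfst continuous_on_snd continuous_on_id) auto
        show "(\<lambda>z. (k (fst z), snd z)) ` (?A1 \<times> {0..1 :: real}) \<subseteq> (M - {a}) \<times> {0..1}"
        proof (rule image_subsetI)
          fix z :: "'a \<times> real" assume "z \<in> ?A1 \<times> {0..1}"
          then have z: "fst z \<in> ?A1" "snd z \<in> {0..1}" unfolding mem_Times_iff by simp_all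
          show "(k (fst z), snd z) \<in> (M - {a}) \<times> {0..1}"
            unfolding mem_Times_iff fst_conv snd_conv by (rule conjI[OF kA1[OF z(1)] z(2)])
        qed
      qed
      show "continuous_on (?A2 \<times> {0..1 :: real}) (\<lambda>z. k (fst z))"
        by (rule kfst) auto
    next
      fix z :: "'a \<times> real" assume "z \<in> ?A1 \<times> {0..1} \<and> fst z \<notin> W \<or> z \<in> ?A2 \<times> {0..1} \<and> fst z \<in> W"
      then have "k (fst z) \<in> M - B" "snd z \<in> {0..1}"
        using LD(2) by (auto simp: N_def)
      then show "R (k (fst z), snd z) = k (fst z)" by (rule R(4))
    qed
    then show ?thesis by (simp only: eq)
  qed
  have kW: "k x \<in> B - {a}" if "x \<in> W" for x
    using that aW WN by (auto simp: N_def)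
  have KM: "K ` (X \<times> {0..1}) \<subseteq> M"
  proof -
    have "R (k x, t) \<in> M" if "x \<in> W" "0 \<le> t" "t \<le> 1" for x t
      using R(2)[unfolded image_subset_iff, rule_format, of "(k x, t)"] kW[OF that(1)] BM that by auto
    then show ?thesis using LD(2) by (auto simp: K_def)
  qed
  have K0: "K (x, 0) = k x" if "x \<in> X" for x
    using that LD(2) by (auto simp: K_def intro!: R(3))
  have KW: "K (x, 1) \<in> D - B" if "x \<in> W" for x
    using that R(5)[OF kW[OF that]] by (simp add: K_def)
  have KnW: "K (x, t) = k x" if "x \<notin> W" for x t
    using that by (simp add: K_def)
  let ?L' = "lift_along M K L"
  have sys': "lift_system X M e (\<lambda>x. K (x, 1)) ?L'"
    by (rule lift_system_lift_along[OF L contK KM K0])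
  have L'_eq: "?L' x \<delta> \<longleftrightarrow> L x \<delta>" if "x \<notin> W" for x \<delta>
    by (rule lift_along_const[OF L]) (rule KnW[OF that])
  have red: "lift_reduction X M e k L (\<lambda>x. K (x, 1)) ?L'"
    unfolding lift_reduction_def
  proof (intro conjI ballI impI sys')
    show "homotopic_with_canon (\<lambda>_. True) X M k (\<lambda>x. K (x, 1))"
      by (rule homotopic_with_canon_homotopy[OF contK KM K0]) auto
    fix x assume "x \<in> X" "K (x, 1) = e"
    \<comment> \<open>Points of \<open>W\<close> end in \<open>D - B\<close>, which does not contain
      \<open>e\<close>; so every root at time 1 is a point that never moved.\<close>
    then have "x \<notin> W" using KW e by metis
    then show "k x = e" "\<forall>\<delta>. ?L' x \<delta> \<longleftrightarrow> L x \<delta>"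
      using KnW[of x 1] L'_eq \<open>K (x, 1) = e\<close> by simp_all
  qed
  have "\<not> ?L' x (\<beta> +++ u)" if u: "path u" "path_image u \<subseteq> B" "pathstart u = a" for u x
  proof
    assume L': "?L' x (\<beta> +++ u)"
    have "K (x, 1) \<in> B" and xX: "x \<in> X"
      using lift_systemD(3,7)[OF sys', OF L'] u(2) pathfinish_in_path_image[of u] by auto
    \<comment> \<open>A point ending in \<open>B\<close> was stationary, so its lift was in the
      sheet from the start, which would put it in \<open>W\<close>.\<close>
    then have x: "x \<notin> W" using KW by blast
    then have "L x (\<beta> +++ u)" "k x \<in> B"
      using L'_eq L' KnW[of x 1] \<open>K (x, 1) \<in> B\<close> by auto
    then show False
      using x u xX by (auto simp: W_def N_def)
  qed
  with red show ?thesis by (rule that)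
qed

text \<open>The missed point slides along the lift of \<open>\<alpha>\<close>, from the base point
  to the point that \<open>\<alpha>\<close> represents. On a short parameter interval
  \<open>\<alpha>\<close> stays in one cell and a single expansion suffices. The Bolzano subdivision
  principle joins the intervals, replacing an explicit partition.\<close>

lemma lift_reduction_chain:
  assumes L: "lift_system X M e k L" and X: "locally path_connected X"
    and cells: "\<forall>z\<in>M. \<exists>B D. cell M B D \<and> z \<in> B \<and> e \<notin> D - B"
    and \<alpha>: "path \<alpha>" "path_image \<alpha> \<subseteq> M" "pathstart \<alpha> = e"
    and avoid: "\<And>x. \<not> L x (\<lambda>_. e)"
  obtains k' L' where "lift_reduction X M e k L k' L'" "\<And>x. \<not> L' x \<alpha>"
proof -
  \<comment> \<open>The predicate quantifies over all maps and lifts because each push changes both.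
    The range guard sits inside it since the Bolzano principle also produces intervals reaching
    beyond \<open>[0, 1]\<close>. The path \<open>\<alpha> \<circ> linepath 0 s\<close> is the
    initial piece of \<open>\<alpha>\<close> up to \<open>s\<close>.\<close>
  define P where "P s t \<longleftrightarrow> (0 \<le> s \<and> t \<le> 1 \<longrightarrow> (\<forall>k L. lift_system X M e k L \<and>
      (\<forall>x. \<not> L x (\<alpha> \<circ> linepath 0 s)) \<longrightarrow>
      (\<exists>k' L'. lift_reduction X M e k L k' L' \<and> (\<forall>x. \<not> L' x (\<alpha> \<circ> linepath 0 t)))))" for s t :: real
  have P01: "P 0 1"
  proof (rule Bolzano[where P = P and a = 0 and b = 1])
    fix a b c :: real assume P: "P a b" "P b c" and ord: "a \<le> b" "b \<le> c"
    show "P a c"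
      unfolding P_def
    proof (intro impI allI)
      fix k L assume ac: "0 \<le> a \<and> c \<le> 1"
        and kL: "lift_system X M e k L \<and> (\<forall>x. \<not> L x (\<alpha> \<circ> linepath 0 a))"
      have ab: "0 \<le> a \<and> b \<le> 1" and bc: "0 \<le> b \<and> c \<le> 1"
        using ac ord by auto
      obtain k' L' where 1: "lift_reduction X M e k L k' L'"
        "\<forall>x. \<not> L' x (\<alpha> \<circ> linepath 0 b)"
        using P(1)[unfolded P_def, rule_format, OF ab, OF kL] by blast
      then have "lift_system X M e k' L' \<and> (\<forall>x. \<not> L' x (\<alpha> \<circ> linepath 0 b))"
        by (simp add: lift_reduction_def)
      from P(2)[unfolded P_def, rule_format, OF bc, OF this]
      obtain k'' L'' where "lift_reduction X M e k' L' k'' L''"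
        "\<forall>x. \<not> L'' x (\<alpha> \<circ> linepath 0 c)"
        by blast
      with 1 lift_reduction_trans show "\<exists>k' L'. lift_reduction X M e k L k' L' \<and> (\<forall>x. \<not> L' x (\<alpha> \<circ> linepath 0 c))"
        by blast
    qed
  next
    fix x :: real assume x: "0 \<le> x" "x \<le> 1"
    then have "\<alpha> x \<in> M" using \<alpha>(2) by (auto simp: path_image_def)
    then obtain B D where B: "cell M B D" "\<alpha> x \<in> B" "e \<notin> D - B" using cells by blast
    then have BM: "B \<subseteq> M" and "openin (top_of_set M) B" by (auto simp: cell_def)
    then have "openin (top_of_set {0..1}) ({0..1} \<inter> \<alpha> -` B)"
      using \<alpha> by (intro continuous_openin_preimage[of _ _ M]) (auto simp: path_def path_image_def)
    then obtain d where d: "d > 0" "\<And>t. t \<in> {0..1} \<Longrightarrow> \<bar>t - x\<bar> < d \<Longrightarrow> \<alpha> t \<in> B"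
      using B(2) x by (force simp: openin_euclidean_subtopology_iff dist_real_def)
    show "\<exists>d>0. \<forall>a b. a \<le> x \<and> x \<le> b \<and> b - a < d \<longrightarrow> P a b"
    proof (intro exI conjI allI impI)
      show "d > 0" by fact
      fix a b assume ab: "a \<le> x \<and> x \<le> b \<and> b - a < d"
      show "P a b"
        unfolding P_def
      proof (intro impI allI)
        fix k L assume bd: "0 \<le> a \<and> b \<le> 1"
          and kL: "lift_system X M e k L \<and> (\<forall>x. \<not> L x (\<alpha> \<circ> linepath 0 a))"
        have inB: "\<alpha> t \<in> B" if "a \<le> t" "t \<le> b" for t
          using that ab bd by (intro d) auto
        have seg: "path (\<alpha> \<circ> linepath s t)" "path_image (\<alpha> \<circ> linepath s t) = \<alpha> ` closed_segment s t"
          if "s \<in> {0..1}" "t \<in> {0..1}" for s t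
        proof -
          have "continuous_on (closed_segment s t) \<alpha>"
            using continuous_on_subset[OF \<alpha>(1)[unfolded path_def]] closed_segment_subset[OF that] by simp
          then show "path (\<alpha> \<circ> linepath s t)"
            by (simp add: path_continuous_image)
        qed (simp add: path_image_compose)
        have seg_M: "path_image (\<alpha> \<circ> linepath s t) \<subseteq> M" if "s \<in> {0..1}" "t \<in> {0..1}" for s t
          using seg(2)[OF that] closed_segment_subset[OF that] \<alpha>(2) by (auto simp: path_image_def)
        have "path (\<alpha> \<circ> linepath 0 a)" "path_image (\<alpha> \<circ> linepath 0 a) \<subseteq> M"
          "pathfinish (\<alpha> \<circ> linepath 0 a) = \<alpha> a"
          using seg seg_M ab bd x by (auto simp: pathfinish_compose)
        moreover have "\<alpha> a \<in> B" using inB ab by auto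
        ultimately obtain k' L' where 1: "lift_reduction X M e k L k' L'"
          "\<And>u x. path u \<Longrightarrow> path_image u \<subseteq> B \<Longrightarrow> pathstart u = \<alpha> a \<Longrightarrow> \<not> L' x ((\<alpha> \<circ> linepath 0 a) +++ u)"
          using lift_reduction_expand[of X M e k L B D "\<alpha> \<circ> linepath 0 a" "\<alpha> a"] kL X B by metis
        have "path (\<alpha> \<circ> linepath a b)" "path_image (\<alpha> \<circ> linepath a b) \<subseteq> B" "pathstart (\<alpha> \<circ> linepath a b) = \<alpha> a"
          using seg[of a b] ab bd x inB by (auto simp: closed_segment_eq_real_ivl pathstart_compose)
        then have 2: "\<not> L' x ((\<alpha> \<circ> linepath 0 a) +++ (\<alpha> \<circ> linepath a b))" for x by (rule 1(2))
        \<comment> \<open>Both sides run along \<open>\<alpha>\<close> from 0 to \<open>b\<close>,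
          so the homotopy is the image of one in the convex interval \<open>[0, 1]\<close>.\<close>
        have "homotopic_paths M (\<alpha> \<circ> linepath 0 b) ((\<alpha> \<circ> linepath 0 a) +++ (\<alpha> \<circ> linepath a b))"
        proof -
          have "homotopic_paths {0..1} (linepath 0 b) (linepath 0 a +++ linepath a b)"
            using ab bd x by (intro homotopic_paths_convex subset_path_image_join)
               (auto simp: closed_segment_eq_real_ivl)
          from homotopic_paths_continuous_image[OF this, of \<alpha> M] show ?thesis
            using \<alpha> by (auto simp: path_compose_join path_def path_image_def)
        qed
        with 2 1(1) have "\<not> L' x (\<alpha> \<circ> linepath 0 b)" for x
          using lift_systemD(8) unfolding lift_reduction_def by metis
        with 1(1) show "\<exists>k' L'. lift_reduction X M e k L k' L' \<and> (\<forall>x. \<not> L' x (\<alpha> \<circ> linepath 0 b))"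
          by blast
      qed
    qed
  qed simp
  have ends: "\<alpha> \<circ> linepath 0 0 = (\<lambda>_. e)" "\<alpha> \<circ> linepath 0 1 = \<alpha>"
    using \<alpha>(3) by (auto simp: linepath_def pathstart_def)
  have "\<exists>k' L'. lift_reduction X M e k L k' L' \<and> (\<forall>x. \<not> L' x \<alpha>)"
    using P01[unfolded P_def, rule_format, of k L] L avoid unfolding ends by simp
  then show ?thesis using that by blast
qed

text \<open>\<open>T\<close> lists representatives of all points over \<open>e\<close> that the lift
  may hit, and each step strikes one from the list. The point of the constant path stays missed
  throughout, so each step can start a fresh chain there.\<close>

lemma root_free_of_finite_loops:
  assumes "finite T" and X: "locally path_connected X"
    and cells: "\<forall>z\<in>M. \<exists>B D. cell M B D \<and> z \<in> B \<and> e \<notin> D - B"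
    and L: "lift_system X M e k L" and avoid: "\<And>x. \<not> L x (\<lambda>_. e)"
    and roots: "\<And>x. x \<in> X \<Longrightarrow> k x = e \<Longrightarrow> \<exists>\<delta>\<in>T. L x \<delta>"
  shows "\<exists>k'. homotopic_with_canon (\<lambda>_. True) X M k k' \<and> (\<forall>x\<in>X. k' x \<noteq> e)"
  using assms(1) L avoid roots
proof (induction T arbitrary: k L rule: finite_induct)
  case empty
  then show ?case
    using lift_reduction_refl[OF empty(1)] unfolding lift_reduction_def by blast
next
  case (insert \<delta> T)
  have "\<exists>k' L'. lift_reduction X M e k L k' L' \<and> (\<forall>x. \<not> L' x \<delta>)"
  \<comment> \<open>A listed \<open>\<delta>\<close> that is hit is known to be a path in
    \<open>M\<close> from \<open>e\<close>, as a chain requires; one that is not hit asks for no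
    push.\<close>
  proof (cases "\<exists>x. L x \<delta>")
    case True
    then obtain x where "L x \<delta>" ..
    note \<delta> = lift_systemD(4-6)[OF insert.prems(1), OF this]
    show ?thesis
      by (rule lift_reduction_chain[OF insert.prems(1) X cells, OF \<delta> insert.prems(2)]) blast
  next
    case False
    then show ?thesis using lift_reduction_refl[OF insert.prems(1)] by blast
  qed
  then obtain k' L' where red: "lift_reduction X M e k L k' L'" "\<And>x. \<not> L' x \<delta>" by blast
  have "\<exists>k''. homotopic_with_canon (\<lambda>_. True) X M k' k'' \<and> (\<forall>x\<in>X. k'' x \<noteq> e)"
  proof (rule insert.IH)
    show "lift_system X M e k' L'" using red(1) by (simp add: lift_reduction_def)
    show "\<not> L' x (\<lambda>_. e)" for x
      by (rule lift_reduction_avoids_loop[OF red(1), OF insert.prems(2)]) simp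
    show "\<exists>\<delta>\<in>T. L' x \<delta>" if "x \<in> X" "k' x = e" for x
      using that red insert.prems(3)[of x] unfolding lift_reduction_def by (metis insertE)
  qed
  then show ?case
    using red(1) homotopic_with_trans unfolding lift_reduction_def by metis
qed

text \<open>There may be infinitely many roots, but nearby roots have the same lift:
  \<open>k\<close> maps a path between them to a loop in one cell, which is null-homotopic. A finite
  subcover of \<open>X\<close> therefore leaves finitely many points over \<open>e\<close> to clear.
  In \<open>good V T\<close>, the finite set \<open>T\<close> represents the lifts of all roots in
  \<open>V\<close>.\<close>

lemma root_free_of_lift_system:
  assumes comp: "compact X" and X: "locally path_connected X"
    and haus: "Hausdorff_space (top_of_set M)" and eM: "e \<in> M"
    and cells: "\<forall>z\<in>M. \<exists>B D. cell M B D \<and> z \<in> B \<and> e \<notin> D - B"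
    and L: "lift_system X M e k L" and avoid: "\<And>x. \<not> L x (\<lambda>_. e)"
    and total: "\<And>x. x \<in> X \<Longrightarrow> \<exists>\<beta>. L x \<beta>"
  shows "\<exists>k'. homotopic_with_canon (\<lambda>_. True) X M k k' \<and> (\<forall>x\<in>X. k' x \<noteq> e)"
proof -
  note LD = lift_systemD[OF L]
  define good where "good V T \<longleftrightarrow> finite T \<and> (\<forall>y\<in>V. k y = e \<longrightarrow> (\<exists>\<delta>\<in>T. L y \<delta>))" for V T
  have "\<exists>V. openin (top_of_set X) V \<and> x \<in> V \<and> (\<exists>T. good V T)" if x: "x \<in> X" for x
  proof (cases "k x = e")
    case False
    have "closedin (top_of_set M) {e}"
      using compactin_imp_closedin[OF haus, of "{e}"] eM by (simp add: compactin_subtopology)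
    then have "openin (top_of_set M) (M - {e})"
      by (metis openin_diff openin_topspace topspace_euclidean_subtopology)
    then have "openin (top_of_set X) (X \<inter> k -` (M - {e}))"
      using LD(1,2) by (intro continuous_openin_preimage[of _ _ M]) auto
    moreover have "good (X \<inter> k -` (M - {e})) {}" by (auto simp: good_def)
    ultimately show ?thesis using False x LD(2) by blast
  next
    case True
    obtain B D where B: "cell M B D" "e \<in> B" using cells eM by blast
    then have BM: "B \<subseteq> M" and "openin (top_of_set M) B"
      and hp: "\<And>p q. path p \<Longrightarrow> path_image p \<subseteq> B \<Longrightarrow> path q \<Longrightarrow> path_image q \<subseteq> B \<Longrightarrow>
        pathstart p = pathstart q \<Longrightarrow> pathfinish p = pathfinish q \<Longrightarrow> homotopic_paths B p q"
      unfolding cell_def by auto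
    then have "openin (top_of_set X) (X \<inter> k -` B)"
      using LD(1,2) by (intro continuous_openin_preimage[of _ _ M]) auto
    moreover have "x \<in> X \<inter> k -` B" using x True B by auto
    ultimately obtain V where V: "openin (top_of_set X) V" "path_connected V" "x \<in> V" "V \<subseteq> X \<inter> k -` B"
      using X unfolding locally_path_connected by metis
    obtain \<delta> where \<delta>: "L x \<delta>" using total[OF x] by blast
    have "L y \<delta>" if y: "y \<in> V" "k y = e" for y
    proof -
      obtain q where q: "path q" "path_image q \<subseteq> V" "pathstart q = x" "pathfinish q = y"
        using V y unfolding path_connected_def by blast
      have kq: "path (k \<circ> q)" "path_image (k \<circ> q) \<subseteq> B" "pathstart (k \<circ> q) = e" "pathfinish (k \<circ> q) = e"
        using q V y True by (auto intro!: path_continuous_image continuous_on_subset[OF LD(1)]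
            simp: path_image_compose pathstart_compose pathfinish_compose)
      have "homotopic_paths M (k \<circ> q) (\<lambda>_. e)"
        using kq B(2) by (intro homotopic_paths_subset[OF hp BM]) auto
      then have "homotopic_paths M (\<delta> +++ (k \<circ> q)) (\<delta> +++ (\<lambda>_. e))"
        using LD(4,5,7)[OF \<delta>] kq True by (intro homotopic_paths_join) auto
      also have "homotopic_paths M \<dots> \<delta>"
        using LD(4,5,7)[OF \<delta>] True by (intro homotopic_paths_rid_const) auto
      finally show ?thesis
        using LD(8)[OF LD(9)[OF \<delta> q(1) _ q(3)]] q V by auto
    qed
    then have "good V {\<delta>}" by (auto simp: good_def)
    with V show ?thesis by blast
  qed
  then have "\<forall>x\<in>X. \<exists>V\<in>{V. openin (top_of_set X) V \<and> (\<exists>T. good V T)}. x \<in> V" by blast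
  then have "X \<subseteq> \<Union>{V. openin (top_of_set X) V \<and> (\<exists>T. good V T)}" by blast
  then obtain \<V> where \<V>: "\<V> \<subseteq> {V. openin (top_of_set X) V \<and> (\<exists>T. good V T)}" "finite \<V>" "X \<subseteq> \<Union>\<V>"
    using comp unfolding compact_eq_openin_cover by (metis (no_types, lifting) mem_Collect_eq)
  have "\<forall>V\<in>\<V>. \<exists>T. good V T" using \<V>(1) by blast
  then obtain T where T: "\<forall>V\<in>\<V>. good V (T V)" by (rule bchoice[THEN exE])
  have "finite (\<Union>V\<in>\<V>. T V)" using \<V>(2) T by (auto simp: good_def)
  moreover have "\<exists>\<delta>\<in>(\<Union>V\<in>\<V>. T V). L x \<delta>" if x: "x \<in> X" "k x = e" for x
  proof -
    obtain V where V: "V \<in> \<V>" "x \<in> V" using x(1) \<V>(3) by blast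
    then have "\<exists>\<delta>\<in>T V. L x \<delta>"
      using T[rule_format, OF V(1)] V(2) x(2) unfolding good_def by simp
    with V(1) show ?thesis by blast
  qed
  ultimately show ?thesis
    by (rule root_free_of_finite_loops[OF _ X cells L, OF _ avoid])
qed

subsection \<open>Suitable manifolds and coincidences\<close>

lemma continuous_on_nbhdI:
  assumes fST: "f ` S \<subseteq> T"
    and nbhd: "\<And>z U. z \<in> S \<Longrightarrow> openin (top_of_set T) U \<Longrightarrow> f z \<in> U \<Longrightarrow>
      \<exists>W. openin (top_of_set S) W \<and> z \<in> W \<and> f ` W \<subseteq> U"
  shows "continuous_on S f"
proof -
  have "openin (top_of_set S) (S \<inter> f -` U)" if U: "openin (top_of_set T) U" for U
  proof (subst openin_subopen, intro ballI)
    fix z assume z: "z \<in> S \<inter> f -` U"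
    with nbhd[of z U] U obtain W where W: "openin (top_of_set S) W" "z \<in> W" "f ` W \<subseteq> U" by auto
    then have "W \<subseteq> S \<inter> f -` U" using openin_imp_subset[OF W(1)] by auto
    with W show "\<exists>W. openin (top_of_set S) W \<and> z \<in> W \<and> W \<subseteq> S \<inter> f -` U" by blast
  qed
  moreover have "f \<in> S \<rightarrow> T" using fST by auto
  ultimately show ?thesis
    by (simp add: continuous_on_open_gen)
qed

lemma continuous_on_local:
  assumes "\<And>z. z \<in> S \<Longrightarrow> \<exists>W. openin (top_of_set S) W \<and> z \<in> W \<and> continuous_on W f"
  shows "continuous_on S f"
proof (rule continuous_on_nbhdI[of _ _ UNIV])
  fix z U assume z: "z \<in> S" and U: "openin (top_of_set UNIV) U" "f z \<in> U"
  obtain W where W: "openin (top_of_set S) W" "z \<in> W" "continuous_on W f"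
    using assms[OF z] by blast
  have "openin (top_of_set W) (W \<inter> f -` U)"
    using W(3) U(1) by (intro continuous_openin_preimage[of _ _ UNIV]) auto
  then have "openin (top_of_set S) (W \<inter> f -` U)" using W(1) openin_trans by blast
  then show "\<exists>W. openin (top_of_set S) W \<and> z \<in> W \<and> f ` W \<subseteq> U"
    using W(2) U(2) by (intro exI[of _ "W \<inter> f -` U"]) auto
qed simp

lemma locally_path_connected_manifold:
  assumes "manifold X"
  shows "locally path_connected X"
  unfolding locally_path_connected
proof (intro allI impI)
  fix V x assume "openin (top_of_set X) V \<and> x \<in> V"
  then obtain B D where "cell X B D" "x \<in> B" "D \<subseteq> V"
    using manifold_cell[OF assms] by metis
  then have "openin (top_of_set X) B \<and> path_connected B \<and> x \<in> B \<and> B \<subseteq> V"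
    unfolding cell_def by (intro conjI) (elim conjE, (assumption | blast))+
  then show "\<exists>U. openin (top_of_set X) U \<and> path_connected U \<and> x \<in> U \<and> U \<subseteq> V" ..
qed

lemma openin_homeo_group_compact_open:
  assumes "compact K" "K \<subseteq> M" "openin (top_of_set M) U"
  shows "openin (homeo_group_topology M) {g \<in> homeo_group M. g ` K \<subseteq> U}"
  unfolding homeo_group_topology_def
  by (rule topology_generated_by_Basis) (use assms in blast)

text \<open>The evaluation map of \<^const>\<open>homeo_group\<close> is continuous because \<open>M\<close> is locally compact.
  Inversion is continuous because \<open>M\<close> is in addition locally connected (Arens): if \<open>g\<close> maps the
  boundary of a cell \<open>B\<close> off a connected set \<open>B'\<close> and some point of \<open>B\<close> into \<open>B'\<close>, then
  \<open>B' \<subseteq> g ` B\<close>.\<close>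

lemma suitable_division:
  fixes M :: "'b::topological_space set"
  assumes M: "manifold M" and suit: "suitable M"
  shows "\<exists>e \<mu> \<tau>. e \<in> M \<and> continuous_on (M \<times> M) \<mu> \<and> continuous_on (M \<times> M) \<tau> \<and>
    (\<forall>x\<in>M. \<mu> (x, x) = e) \<and>
    (\<forall>x\<in>M. \<forall>y\<in>M. \<mu> (x, y) \<in> M \<and> \<tau> (x, y) \<in> M \<and> \<tau> (x, \<mu> (x, y)) = y \<and> \<mu> (x, \<tau> (x, y)) = y)"
proof -
  obtain e \<theta> where e: "e \<in> M" and \<theta>: "continuous_map (top_of_set M) (homeo_group_topology M) \<theta>"
    and \<theta>e: "\<And>x. x \<in> M \<Longrightarrow> \<theta> x x = e"
    using suit unfolding suitable_def by blast
  have haus: "Hausdorff_space (top_of_set M)" using M by (simp add: manifold_def)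
  have "\<theta> x \<in> homeo_group M" if "x \<in> M" for x
    using continuous_map_image_subset_topspace[OF \<theta>] that by (auto simp: topspace_homeo_group_topology)
  then have "\<forall>x\<in>M. \<exists>g'. homeomorphism M M (\<theta> x) g'" by (simp add: homeo_group_def)
  then obtain \<theta>' where hom: "\<And>x. x \<in> M \<Longrightarrow> homeomorphism M M (\<theta> x) (\<theta>' x)" by metis
  have \<theta>M: "\<theta> x y \<in> M" and \<theta>'M: "\<theta>' x y \<in> M" and inv1: "\<theta>' x (\<theta> x y) = y" and inv2: "\<theta> x (\<theta>' x y) = y"
    if "x \<in> M" "y \<in> M" for x y
    using hom[OF that(1)] that(2) by (auto simp: homeomorphism_def)
  have cont\<theta>: "continuous_on M (\<theta> x)" if "x \<in> M" for x
    using hom[OF that] by (simp add: homeomorphism_def)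
  have sub: "openin (top_of_set M) {x \<in> M. \<theta> x ` K \<subseteq> U}"
    if "compact K" "K \<subseteq> M" "openin (top_of_set M) U" for K U
  proof -
    have "{x \<in> M. \<theta> x ` K \<subseteq> U} = {x \<in> topspace (top_of_set M). \<theta> x \<in> {g \<in> homeo_group M. g ` K \<subseteq> U}}"
      using \<open>\<And>x. x \<in> M \<Longrightarrow> \<theta> x \<in> homeo_group M\<close> by auto
    then show ?thesis
      using openin_continuous_map_preimage[OF \<theta> openin_homeo_group_compact_open[OF that]] by simp
  qed
  \<comment> \<open>The homeomorphisms are replaced by a jointly continuous operation
    \<open>\<mu>\<close> and its division \<open>\<tau>\<close> in the second argument; only these
    are used from here on.\<close>
  define \<mu> where "\<mu> = (\<lambda>z. \<theta> (fst z) (snd z))"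
  define \<tau> where "\<tau> = (\<lambda>z. \<theta>' (fst z) (snd z))"
  have closedD: "closedin (top_of_set M) K" if "compact K" "K \<subseteq> M" for K
    using compactin_imp_closedin[OF haus, of K] that by (simp add: compactin_subtopology)
  have "continuous_on (M \<times> M) \<mu>"
  proof (rule continuous_on_nbhdI)
    show "\<mu> ` (M \<times> M) \<subseteq> M" using \<theta>M by (auto simp: \<mu>_def)
    fix z U assume z: "z \<in> M \<times> M" and U: "openin (top_of_set M) U" "\<mu> z \<in> U"
    obtain x y where xy: "z = (x, y)" "x \<in> M" "y \<in> M" using z by auto
    have "openin (top_of_set M) (M \<inter> \<theta> x -` U)"
      using cont\<theta> \<theta>M xy U by (intro continuous_openin_preimage[of _ _ M]) auto
    moreover have "y \<in> M \<inter> \<theta> x -` U" using xy U by (simp add: \<mu>_def)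
    ultimately obtain B D where B: "cell M B D" "y \<in> B" "D \<subseteq> M \<inter> \<theta> x -` U"
      using manifold_cell[OF M] by metis
    then have B': "openin (top_of_set M) B" "B \<subseteq> D" "compact D" "D \<subseteq> M" by (simp_all add: cell_def)
    \<comment> \<open>Local compactness: the compact neighbourhood \<open>D\<close> of
      \<open>y\<close> turns the condition on \<open>\<theta> x'\<close> into a subbasic open one,
      and \<open>B\<close> gives room to move \<open>y\<close>.\<close>
    let ?W = "{x' \<in> M. \<theta> x' ` D \<subseteq> U} \<times> B"
    have "openin (top_of_set (M \<times> M)) ?W"
      by (intro openin_Times sub B' U)
    moreover have "z \<in> ?W" using xy B by auto
    moreover have "\<mu> ` ?W \<subseteq> U"
    proof -
      have "\<theta> x' y' \<in> U" if "\<theta> x' ` D \<subseteq> U" "y' \<in> B" for x' y'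
        using that B'(2) by blast
      then show ?thesis by (auto simp: \<mu>_def)
    qed
    ultimately show "\<exists>W. openin (top_of_set (M \<times> M)) W \<and> z \<in> W \<and> \<mu> ` W \<subseteq> U" by blast
  qed
  moreover have "continuous_on (M \<times> M) \<tau>"
  proof (rule continuous_on_nbhdI)
    show "\<tau> ` (M \<times> M) \<subseteq> M" using \<theta>'M by (auto simp: \<tau>_def)
    fix z U assume z: "z \<in> M \<times> M" and U: "openin (top_of_set M) U" "\<tau> z \<in> U"
    obtain x y where xy: "z = (x, y)" "x \<in> M" "y \<in> M" using z by auto
    define w where "w = \<theta>' x y"
    have w: "w \<in> U" "w \<in> M" "\<theta> x w = y" using xy U \<theta>'M inv2 by (auto simp: w_def \<tau>_def)
    obtain B D where B: "cell M B D" "w \<in> B" "D \<subseteq> U"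
      using manifold_cell[OF M U(1) w(1)] by metis
    then have opB: "openin (top_of_set M) B" and BD: "B \<subseteq> D" and cD: "compact D" and DM: "D \<subseteq> M"
      by (simp_all add: cell_def)
    have op_im: "openin (top_of_set M) (\<theta> x' ` B)" if "x' \<in> M" for x'
      by (rule homeomorphism_imp_open_map[OF hom[OF that] opB])
    have "y \<in> \<theta> x ` B" using w B by auto
    then obtain B' D' where B': "cell M B' D'" "y \<in> B'" "D' \<subseteq> \<theta> x ` B"
      using manifold_cell[OF M op_im[OF xy(2)]] by metis
    then have opB': "openin (top_of_set M) B'" and BD': "B' \<subseteq> D'" and cD': "compact D'" and DM': "D' \<subseteq> M"
      and conn: "connected B'"
      by (simp_all add: cell_def path_connected_imp_connected)
    have opD': "openin (top_of_set M) (M - D')"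
      using closedD[OF cD' DM'] by (metis openin_diff openin_topspace topspace_euclidean_subtopology)
    have "closedin (top_of_set D) (D - B)"
    proof -
      have "openin (top_of_set D) B" using opB BD DM by (meson openin_subset_trans)
      then show ?thesis by (metis closedin_diff closedin_topspace topspace_euclidean_subtopology)
    qed
    then have cDB: "compact (D - B)" using cD closedin_compact by blast
    \<comment> \<open>Subbasic conditions: compact \<open>D - B\<close> must avoid
      \<open>D'\<close>, and one point of \<open>B\<close> must land in \<open>B'\<close>. Avoiding
      the closed \<open>D'\<close>, rather than just \<open>B'\<close>, makes the first target
      open.\<close>
    let ?W1 = "{x' \<in> M. \<theta> x' ` (D - B) \<subseteq> M - D'}" and ?W2 = "{x' \<in> M. \<theta> x' ` {w} \<subseteq> B'}"
    have "openin (top_of_set M) (?W1 \<inter> ?W2)"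
      using DM w by (intro openin_Int sub cDB opD' opB') auto
    then have "openin (top_of_set (M \<times> M)) ((?W1 \<inter> ?W2) \<times> B')"
      by (rule openin_Times[OF _ opB'])
    moreover have "x \<in> ?W1"
    proof -
      have "\<theta> x v \<notin> D'" if v: "v \<in> D - B" for v
      proof
        assume "\<theta> x v \<in> D'"
        then obtain b where b: "b \<in> B" "\<theta> x v = \<theta> x b" using B'(3) by blast
        then have "v = b" using inv1[OF xy(2), of v] inv1[OF xy(2), of b] v BD DM by auto
        with v b show False by blast
      qed
      then show ?thesis using xy(2) \<theta>M DM by blast
    qed
    moreover have "x \<in> ?W2" using xy w B' by auto
    moreover have "\<tau> ` ((?W1 \<inter> ?W2) \<times> B') \<subseteq> U"
    proof -
      have "\<theta>' x' y' \<in> U" if x': "x' \<in> M" "\<theta> x' ` (D - B) \<subseteq> M - D'" "\<theta> x' w \<in> B'" and y': "y' \<in> B'" for x' y'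
      proof -
        \<comment> \<open>Open because \<open>\<theta> x'\<close> is an open map, and closed because
          the image of \<open>D - B\<close> avoids \<open>B'\<close>, so that \<open>B\<close> may
          be replaced by the compact \<open>D\<close>. Since \<open>B'\<close> is connected and the
          image of \<open>w\<close> lies in \<open>?T\<close>, it is all of
          \<open>B'\<close>.\<close>
        let ?T = "\<theta> x' ` B \<inter> B'"
        have "openin (top_of_set B') ?T"
          using op_im[OF x'(1)] opB' by (metis openin_Int openin_subset_trans inf_le2 openin_imp_subset)
        moreover have "closedin (top_of_set B') ?T"
        proof -
          have "compact (\<theta> x' ` D)"
            using cont\<theta>[OF x'(1)] DM cD by (meson compact_continuous_image continuous_on_subset)
          then have "closedin (top_of_set M) (\<theta> x' ` D)"
            by (rule closedD) (use DM \<theta>M x' in auto)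
          then have "closedin (top_of_set B') (B' \<inter> \<theta> x' ` D)"
            using opB' openin_imp_subset[OF opB'] by (auto simp: closedin_closed)
          moreover have "B' \<inter> \<theta> x' ` D = ?T" using x'(2) BD BD' by auto
          ultimately show ?thesis by simp
        qed
        ultimately have "?T = {} \<or> ?T = B'" using conn unfolding connected_clopen by blast
        moreover have "\<theta> x' w \<in> ?T" using x' B by auto
        ultimately have "y' \<in> \<theta> x' ` B" using y' by blast
        then obtain b where b: "b \<in> B" "y' = \<theta> x' b" by blast
        then have "b \<in> U" "b \<in> M" using BD DM B(3) by blast+
        then show ?thesis using inv1[OF x'(1)] b(2) by simp
      qed
      then show ?thesis by (auto simp: \<tau>_def)
    qed
    ultimately show "\<exists>W. openin (top_of_set (M \<times> M)) W \<and> z \<in> W \<and> \<tau> ` W \<subseteq> U"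
      using xy(1) B'(2) by (intro exI[of _ "(?W1 \<inter> ?W2) \<times> B'"]) simp
  qed
  ultimately show ?thesis
    using e \<theta>M \<theta>'M inv1 inv2 \<theta>e
    by (intro exI[of _ e] exI[of _ \<mu>] exI[of _ \<tau>]) (simp add: \<mu>_def \<tau>_def)
qed

text \<open>The assumption \<open>none\<close> is inessentiality of the class of \<open>x0\<close>,
  stated for roots: after the homotopy \<open>G\<close>, the lift of \<open>g\<close> that starts at
  the base point no longer hits the base point. This is the missed point from which all chains
  start.\<close>

lemma root_free_path_connected:
  assumes X: "compact X" "path_connected X" "locally path_connected X" and M: "manifold M" and e: "e \<in> M"
    and G: "continuous_on (X \<times> {0..1}) G" "G ` (X \<times> {0..1}) \<subseteq> M" "\<And>x. x \<in> X \<Longrightarrow> G (x, 0) = g x"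
    and x0: "x0 \<in> X" "g x0 = e"
    and none: "\<And>p. path p \<Longrightarrow> path_image p \<subseteq> X \<Longrightarrow> pathstart p = x0 \<Longrightarrow>
      \<not> homotopic_paths M (\<lambda>t. G (p t, t)) (\<lambda>_. e)"
  shows "\<exists>k. homotopic_with_canon (\<lambda>_. True) X M g k \<and> (\<forall>x\<in>X. k x \<noteq> e)"
proof -
  \<comment> \<open>The lift of \<open>g\<close> sending \<open>x0\<close> to the base point, in the
    covering that belongs to the image of the fundamental group of \<open>X\<close>: all paths
    \<open>p\<close> from \<open>x0\<close> to \<open>x\<close> represent the same point. The choice
    of a root for \<open>x0\<close> makes \<open>g \<circ> p\<close> start at
    \<open>e\<close>.\<close>
  define L where "L x \<beta> \<longleftrightarrow> (\<exists>p. path p \<and> path_image p \<subseteq> X \<and> pathstart p = x0 \<and> pathfinish p = x \<and>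
      homotopic_paths M (g \<circ> p) \<beta>)" for x \<beta>
  have "continuous_on X (\<lambda>x. G (x, 0))"
    by (rule continuous_on_compose2[OF G(1)]) (auto intro!: continuous_intros)
  then have gc: "continuous_on X g" using G(3) by (simp cong: continuous_on_cong)
  have gM: "g x \<in> M" if "x \<in> X" for x
    using G(2)[unfolded image_subset_iff, rule_format, of "(x, 0)"] G(3)[OF that] that by simp
  have gp: "path (g \<circ> p)" "path_image (g \<circ> p) \<subseteq> M" if "path p" "path_image p \<subseteq> X" for p
    using that gM by (auto intro!: path_continuous_image continuous_on_subset[OF gc] simp: path_image_compose)
  have sys: "lift_system X M e g L"
    unfolding lift_system_def
  proof (intro conjI allI impI)
    show "continuous_on X g" by (rule gc)
    show "g ` X \<subseteq> M" using gM by blast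
  next
    fix x \<beta> assume "L x \<beta>"
    then obtain p where p: "path p" "path_image p \<subseteq> X" "pathstart p = x0" "pathfinish p = x"
      "homotopic_paths M (g \<circ> p) \<beta>" by (auto simp: L_def)
    show "x \<in> X" using p pathfinish_in_path_image[of p] by auto
    show "path \<beta>" "path_image \<beta> \<subseteq> M"
      using homotopic_paths_imp_path[OF p(5)] homotopic_paths_imp_subset[OF p(5)] by auto
    show "pathstart \<beta> = e" "pathfinish \<beta> = g x"
      using homotopic_paths_imp_pathstart[OF p(5)] homotopic_paths_imp_pathfinish[OF p(5)] p x0
      by (simp_all add: pathstart_compose pathfinish_compose)
  next
    fix x \<beta> \<beta>' assume "L x \<beta> \<and> homotopic_paths M \<beta> \<beta>'"
    then show "L x \<beta>'" unfolding L_def using homotopic_paths_trans by blast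
  next
    fix x \<beta> q assume as: "L x \<beta> \<and> path q \<and> path_image q \<subseteq> X \<and> pathstart q = x"
    then obtain p where p: "path p" "path_image p \<subseteq> X" "pathstart p = x0" "pathfinish p = x"
      "homotopic_paths M (g \<circ> p) \<beta>" by (auto simp: L_def)
    have "homotopic_paths M (g \<circ> (p +++ q)) (\<beta> +++ (g \<circ> q))"
      unfolding path_compose_join
      by (rule homotopic_paths_join[OF p(5)]) (use gp as p in \<open>auto simp: pathstart_compose pathfinish_compose\<close>)
    moreover have "path (p +++ q)" "path_image (p +++ q) \<subseteq> X" "pathstart (p +++ q) = x0"
        "pathfinish (p +++ q) = pathfinish q"
      using as p by (simp_all add: subset_path_image_join)
    ultimately show "L (pathfinish q) (\<beta> +++ (g \<circ> q))" unfolding L_def by blast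
  qed
  have Gx: "path (\<lambda>t. G (x, t))" "path_image (\<lambda>t. G (x, t)) \<subseteq> M" "pathstart (\<lambda>t. G (x, t)) = g x" if x: "x \<in> X" for x
  proof -
    show "path (\<lambda>t. G (x, t))"
      unfolding path_def
      by (rule continuous_on_compose2[OF G(1)]) (use x in \<open>auto intro!: continuous_intros\<close>)
    show "path_image (\<lambda>t. G (x, t)) \<subseteq> M"
      using x G(2) by (auto simp: path_image_def)
    show "pathstart (\<lambda>t. G (x, t)) = g x" using G(3)[OF x] by (simp add: pathstart_def)
  qed
  let ?L = "lift_along M G L"
  have sys': "lift_system X M e (\<lambda>x. G (x, 1)) ?L"
    by (rule lift_system_lift_along[OF sys G])
  have avoid: "\<not> ?L x (\<lambda>_. e)" for x
  proof
    assume "?L x (\<lambda>_. e)"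
    then obtain \<beta> p where p: "path p" "path_image p \<subseteq> X" "pathstart p = x0" "pathfinish p = x"
      "homotopic_paths M (g \<circ> p) \<beta>" and \<beta>: "homotopic_paths M (\<beta> +++ (\<lambda>t. G (x, t))) (\<lambda>_. e)"
      by (auto simp: lift_along_def L_def)
    have x: "x \<in> X" using p pathfinish_in_path_image[of p] by auto
    have "homotopic_paths M (\<lambda>t. G (p t, 0)) (g \<circ> p)"
      using gp[OF p(1,2)] p(2)
      by (intro homotopic_paths_sym[OF homotopic_paths_eq]) (auto simp: path_image_def subset_iff G(3))
    then have 1: "homotopic_paths M (\<lambda>t. G (p t, 0)) \<beta>"
      using p(5) homotopic_paths_trans by blast
    \<comment> \<open>The path \<open>g \<circ> p\<close> followed by the track of its end is
      homotopic to the diagonal path, the form in which \<open>none\<close> excludes it.\<close>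
    have "homotopic_paths M (\<lambda>t. G (p t, t)) ((\<lambda>t. G (p t, 0)) +++ (\<lambda>t. G (x, t)))"
      using homotopic_paths_across_homotopy(2)[OF G(1,2) p(1,2)] p(4) by simp
    also have "homotopic_paths M \<dots> (\<beta> +++ (\<lambda>t. G (x, t)))"
      by (rule homotopic_paths_join[OF 1]) (use Gx[OF x] p x G(3) in \<open>auto simp: pathfinish_def\<close>)
    also note \<beta>
    finally show False using none p by blast
  qed
  have total: "\<exists>\<beta>. ?L x \<beta>" if x: "x \<in> X" for x
  proof -
    obtain p where p: "path p" "path_image p \<subseteq> X" "pathstart p = x0" "pathfinish p = x"
      using X(2) x x0 unfolding path_connected_def by blast
    have "L x (g \<circ> p)" unfolding L_def using p gp by auto
    moreover have "homotopic_paths M ((g \<circ> p) +++ (\<lambda>t. G (x, t))) ((g \<circ> p) +++ (\<lambda>t. G (x, t)))"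
      using p gp Gx[OF x] by (simp add: subset_path_image_join pathfinish_compose)
    ultimately show ?thesis unfolding lift_along_def by blast
  qed
  have cells: "\<forall>z\<in>M. \<exists>B D. cell M B D \<and> z \<in> B \<and> e \<notin> D - B"
    using manifold_cell[OF M openin_subtopology_self] by metis
  have haus: "Hausdorff_space (top_of_set M)" using M by (simp add: manifold_def)
  obtain k where k: "homotopic_with_canon (\<lambda>_. True) X M (\<lambda>x. G (x, 1)) k" "\<forall>x\<in>X. k x \<noteq> e"
    using root_free_of_lift_system[OF X(1,3) haus e cells sys', OF avoid total] by blast
  have "homotopic_with_canon (\<lambda>_. True) X M g (\<lambda>x. G (x, 1))"
    by (rule homotopic_with_canon_homotopy[OF G]) auto
  with k homotopic_with_trans show ?thesis by blast
qed

theorem theorem4p4: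
  fixes X :: "'a::topological_space set" and M :: "'b::topological_space set"
    and f h :: "'a \<Rightarrow> 'b"
  assumes "manifold X" and "compact X"
    and "manifold M" and "suitable M"
    and "continuous_on X f" and "f ` X \<subseteq> M"
    and "continuous_on X h" and "h ` X \<subseteq> M"
    and "nielsen_number X M f h = 0"
  shows "\<exists>h'. homotopic_with_canon (\<lambda>_. True) X M h h' \<and> Coin X f h' = {}"
proof -
  obtain e :: 'b and \<mu> \<tau> :: "'b \<times> 'b \<Rightarrow> 'b" where e: "e \<in> M"
    and c\<mu>: "continuous_on (M \<times> M) \<mu>" and c\<tau>: "continuous_on (M \<times> M) \<tau>"
    and diag: "\<forall>x\<in>M. \<mu> (x, x) = e"
    and div: "\<forall>x\<in>M. \<forall>y\<in>M. \<mu> (x, y) \<in> M \<and> \<tau> (x, y) \<in> M \<and>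
      \<tau> (x, \<mu> (x, y)) = y \<and> \<mu> (x, \<tau> (x, y)) = y"
    using suitable_division[OF assms(3,4)] by (elim exE conjE) (rule that)
  have \<mu>M: "\<mu> (x, y) \<in> M" and \<tau>M: "\<tau> (x, y) \<in> M"
    and \<tau>\<mu>: "\<tau> (x, \<mu> (x, y)) = y" and \<mu>\<tau>: "\<mu> (x, \<tau> (x, y)) = y" if "x \<in> M" "y \<in> M" for x y
    using div that by simp_all
  have \<mu>e: "\<mu> (x, x) = e" if "x \<in> M" for x using diag that by simp
  have lpc: "locally path_connected X" by (rule locally_path_connected_manifold[OF assms(1)])
  have fM: "f x \<in> M" and hM: "h x \<in> M" if "x \<in> X" for x using that assms(6,8) by auto
  have \<mu>e_iff: "\<mu> (x, y) = e \<longleftrightarrow> x = y" if "x \<in> M" "y \<in> M" for x y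
    using \<tau>\<mu>[OF that(1,1)] \<tau>\<mu>[OF that] \<mu>e[OF that(1)] by metis
  define g where "g x = \<mu> (f x, h x)" for x
  have gc: "continuous_on X g"
    unfolding g_def
    by (rule continuous_on_compose2[OF c\<mu>]) (use fM hM assms in \<open>auto intro!: continuous_on_Pair\<close>)
  have gM: "g x \<in> M" if "x \<in> X" for x using \<mu>M fM hM that by (simp add: g_def)
  have inessential: "geom_inessential X M f h C" if "C \<in> coincidence_classes X M f h" for C
  proof -
    \<comment> \<open>The value 0 rules out the infinite case of \<open>nielsen_number\<close>, so
      the zero cardinality really means an empty set.\<close>
    have "finite (essential_classes X M f h)" "card (essential_classes X M f h) = 0"
      using assms(9) by (auto simp: nielsen_number_def zero_enat_def split: if_splits)
    then have "essential_classes X M f h = {}" by simp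
    with that show ?thesis by (auto simp: essential_classes_def)
  qed
  \<comment> \<open>This puts a coincidence into its own class, as needed for the ends of a path in
    \<open>related_classes\<close>.\<close>
  have nielsen_refl: "(x, x) \<in> nielsen_rel X M a b" if "x \<in> Coin X a b" "a x \<in> M" for x and a b :: "'a \<Rightarrow> 'b"
  proof -
    have "homotopic_paths M (a \<circ> (\<lambda>_. x)) (b \<circ> (\<lambda>_. x))"
      using that by (simp add: comp_def Coin_def)
    moreover have "x \<in> X" using that(1) by (simp add: Coin_def)
    ultimately show ?thesis
      using that(1) unfolding nielsen_rel_def by (auto intro!: exI[of _ "\<lambda>_. x"])
  qed
  \<comment> \<open>Path components are treated one at a time, since a class is removed and its
    missed point moved only along paths within one component. A component without roots keeps
    \<open>g\<close> fixed.\<close>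
  have component: "\<exists>K. continuous_on (P \<times> {0..1 :: real}) K \<and> K ` (P \<times> {0..1}) \<subseteq> M \<and>
      (\<forall>x\<in>P. K (x, 0) = g x \<and> K (x, 1) \<noteq> e)"
    if "P \<in> path_component_set X ` X" for P
  proof (cases "\<exists>x\<in>P. g x = e")
    case False
    have "P \<subseteq> X" using that path_component_subset by blast
    then have "continuous_on (P \<times> {0..1 :: real}) (\<lambda>z. g (fst z))"
      by (intro continuous_on_compose2[OF gc continuous_on_fst[OF continuous_on_id]]) auto
    with False \<open>P \<subseteq> X\<close> gM show ?thesis
      by (intro exI[of _ "\<lambda>z. g (fst z)"]) auto
  next
    case True
    then obtain x0 where x0: "x0 \<in> P" "g x0 = e" by blast
    have PX: "P \<subseteq> X" using that path_component_subset by blast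
    have P: "compact P" "path_connected P" "locally path_connected P"
    proof -
      obtain x where P: "P = path_component_set X x"
        using \<open>P \<in> path_component_set X ` X\<close> by blast
      show "compact P"
        unfolding P
        by (rule closedin_compact[OF assms(2) closedin_path_component_locally_path_connected[OF lpc]])
      show "path_connected P" unfolding P by simp
      show "locally path_connected P"
        unfolding P by (rule locally_path_connected_path_component[OF lpc])
    qed
    have x0X: "x0 \<in> X" using x0 PX by blast
    have x0C: "x0 \<in> Coin X f h"
      using x0 x0X \<mu>e_iff fM hM by (simp add: Coin_def g_def)
    define C where "C = nielsen_rel X M f h `` {x0}"
    have "C \<in> coincidence_classes X M f h"
      unfolding C_def coincidence_classes_def by (rule quotientI[OF x0C])
    then obtain F H where F: "homotopy_from X M F f" and H: "homotopy_from X M H h"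
      and unrelated: "\<And>C'. C' \<in> coincidence_classes X M (\<lambda>x. F (x, 1)) (\<lambda>x. H (x, 1)) \<Longrightarrow>
        \<not> related_classes X M F H C C'"
      using inessential unfolding geom_inessential_def by blast
    have Fc: "continuous_on (X \<times> {0..1}) F" and F0: "\<And>x. x \<in> X \<Longrightarrow> F (x, 0) = f x"
      and FM: "\<And>x t. x \<in> X \<Longrightarrow> t \<in> {0..1} \<Longrightarrow> F (x, t) \<in> M"
      using F by (auto simp: homotopy_from_def)
    have Hc: "continuous_on (X \<times> {0..1}) H" and H0: "\<And>x. x \<in> X \<Longrightarrow> H (x, 0) = h x"
      and HM: "\<And>x t. x \<in> X \<Longrightarrow> t \<in> {0..1} \<Longrightarrow> H (x, t) \<in> M"
      using H by (auto simp: homotopy_from_def)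
    define G where "G z = \<mu> (F z, H z)" for z
    have Gc: "continuous_on (P \<times> {0..1}) G"
      unfolding G_def
    proof (rule continuous_on_compose2[OF c\<mu>])
      have "P \<times> {0..1} \<subseteq> X \<times> {0..1 :: real}" using PX by auto
      then show "continuous_on (P \<times> {0..1}) (\<lambda>z. (F z, H z))"
        by (intro continuous_on_Pair continuous_on_subset[OF Fc] continuous_on_subset[OF Hc])
      show "(\<lambda>z. (F z, H z)) ` (P \<times> {0..1}) \<subseteq> M \<times> M"
        using PX FM HM by auto
    qed
    have GM: "G ` (P \<times> {0..1}) \<subseteq> M"
      using PX FM HM \<mu>M by (auto simp: G_def)
    have G0: "G (x, 0) = g x" if "x \<in> P" for x
      using that PX F0 H0 by (auto simp: G_def g_def)
    \<comment> \<open>A null-homotopic diagonal of \<open>G\<close> ends at a coincidence of the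
      deformed pair, whose class would be related to the class of \<open>x0\<close> by the same path
      \<open>p\<close>.\<close>
    have none: "\<not> homotopic_paths M (\<lambda>t. G (p t, t)) (\<lambda>_. e)"
      if p: "path p" "path_image p \<subseteq> P" "pathstart p = x0" for p
    proof
      assume hp: "homotopic_paths M (\<lambda>t. G (p t, t)) (\<lambda>_. e)"
      have pX: "path_image p \<subseteq> X" using p PX by blast
      then have ptX: "p t \<in> X" if "t \<in> {0..1}" for t using that by (auto simp: path_image_def)
      define x where "x = pathfinish p"
      have xX: "x \<in> X" using ptX[of 1] by (simp add: x_def pathfinish_def)
      have "G (x, 1) = e"
        using homotopic_paths_imp_pathfinish[OF hp] by (simp add: x_def pathfinish_def)
      then have "F (x, 1) = H (x, 1)" using \<mu>e_iff FM HM xX by (simp add: G_def)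
      then have xC: "x \<in> Coin X (\<lambda>x. F (x, 1)) (\<lambda>x. H (x, 1))" using xX by (simp add: Coin_def)
      define C' where "C' = nielsen_rel X M (\<lambda>x. F (x, 1)) (\<lambda>x. H (x, 1)) `` {x}"
      have C': "C' \<in> coincidence_classes X M (\<lambda>x. F (x, 1)) (\<lambda>x. H (x, 1))"
        unfolding C'_def coincidence_classes_def by (rule quotientI[OF xC])
      have xC': "x \<in> C'" unfolding C'_def using nielsen_refl[OF xC] FM xX by simp
      have x0C': "x0 \<in> C" unfolding C_def using nielsen_refl[OF x0C] fM x0X by simp
      obtain c where c: "continuous_on ({0..1} \<times> {0..1}) c" "c \<in> {0..1} \<times> {0..1} \<rightarrow> M"
        "\<And>t. t \<in> {0..1} \<Longrightarrow> c (0, t) = G (p t, t)" "\<And>t. t \<in> {0..1} \<Longrightarrow> c (1, t) = e"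
        "\<And>s. s \<in> {0..1 :: real} \<Longrightarrow> c (s, 0) = G (p 0, 0)" "\<And>s. s \<in> {0..1} \<Longrightarrow> c (s, 1 :: real) = G (p 1, 1)"
        using hp unfolding homotopic_paths by (auto simp: pathstart_def pathfinish_def)
      have pc: "continuous_on {0..1} p" using p(1) by (simp add: path_def)
      have Fp: "continuous_on {0..1} (\<lambda>t. F (p t, t))"
        by (rule continuous_on_compose2[OF Fc]) (use ptX pc in \<open>auto intro!: continuous_on_Pair continuous_on_id\<close>)
      have "homotopic_paths M (\<lambda>t. H (p t, t)) (\<lambda>t. F (p t, t))"
        unfolding homotopic_paths
      proof (intro exI conjI ballI)
        \<comment> \<open>Dividing the null-homotopy \<open>c\<close> of the
          \<open>G\<close>-diagonal by the \<open>F\<close>-diagonal turns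
          \<open>\<mu> (F, H)\<close> into \<open>H\<close> at one end and
          \<open>e = \<mu> (F, F)\<close> into \<open>F\<close> at the other, with end points
          fixed.\<close>
        let ?c = "\<lambda>z. \<tau> (F (p (snd z), snd z), c z)"
        have "continuous_on ({0..1} \<times> {0..1}) (\<lambda>z :: real \<times> real. F (p (snd z), snd z))"
          by (rule continuous_on_compose2[OF Fp continuous_on_snd[OF continuous_on_id]]) auto
        then show "continuous_on ({0..1} \<times> {0..1}) ?c"
          by (intro continuous_on_compose2[OF c\<tau> continuous_on_Pair[OF _ c(1)]])
             (use FM ptX c(2) in auto)
        show "?c \<in> {0..1} \<times> {0..1} \<rightarrow> M"
          using c(2) by (auto intro!: \<tau>M FM ptX)
        fix t :: real assume t: "t \<in> {0..1}"
        show "?c (0, t) = H (p t, t)"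
          using t c(3) \<tau>\<mu> FM HM ptX by (simp add: G_def)
        have e1: "\<tau> (y, e) = y" if "y \<in> M" for y
          using \<tau>\<mu>[OF that that] \<mu>e[OF that] by simp
        show "?c (1, t) = F (p t, t)"
          using t c(4) e1 FM ptX by simp
        show "pathstart (?c \<circ> Pair t) = pathstart (\<lambda>t. H (p t, t))"
          using t c(5) \<tau>\<mu> FM HM ptX by (simp add: G_def pathstart_def)
        show "pathfinish (?c \<circ> Pair t) = pathfinish (\<lambda>t. H (p t, t))"
          using t c(6) \<tau>\<mu> FM HM ptX by (simp add: G_def pathfinish_def)
      qed
      then have "homotopic_paths M (\<lambda>t. F (p t, t)) (\<lambda>t. H (p t, t))"
        by (rule homotopic_paths_sym)
      then have "related_classes X M F H C C'"
        unfolding related_classes_def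
        using p pX xC' x0C' x_def by (intro exI[of _ p]) simp
      with unrelated[OF C'] show False by contradiction
    qed
    obtain k where k: "homotopic_with_canon (\<lambda>_. True) P M g k" "\<forall>x\<in>P. k x \<noteq> e"
      using root_free_path_connected[OF P assms(3) e Gc GM G0 x0 none] by blast
    obtain K where "continuous_on (P \<times> {0..1 :: real}) K" "K ` (P \<times> {0..1}) \<subseteq> M"
      "\<And>x. K (x, 0) = g x" "\<And>x. K (x, 1) = k x"
      using homotopic_with_canon_imp_homotopy[OF k(1)] by metis
    with k(2) show ?thesis
      by (intro exI[of _ K]) simp
  qed
  obtain \<K> where \<K>: "\<forall>P\<in>path_component_set X ` X. continuous_on (P \<times> {0..1 :: real}) (\<K> P) \<and>
      \<K> P ` (P \<times> {0..1}) \<subseteq> M \<and> (\<forall>x\<in>P. \<K> P (x, 0) = g x \<and> \<K> P (x, 1) \<noteq> e)"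
    using component by (metis (no_types, lifting) bchoice)
  define K where "K z = \<K> (path_component_set X (fst z)) z" for z
  have self: "x \<in> path_component_set X x" if "x \<in> X" for x
    using that by (simp add: path_component_refl)
  have KM: "K (x, t) \<in> M" if "x \<in> X" "t \<in> {0..1}" for x t
    using \<K>[rule_format, OF imageI[OF that(1)]] self[OF that(1)] that(2) by (auto simp: K_def)
  have K0: "K (x, 0) = g x" and K1: "K (x, 1) \<noteq> e" if "x \<in> X" for x
    using \<K>[rule_format, OF imageI[OF that]] self[OF that] by (auto simp: K_def)
  \<comment> \<open>Path components are open because \<open>X\<close> is locally path connected, and
    on each of them \<open>K\<close> is a single chosen homotopy.\<close>
  have Kc: "continuous_on (X \<times> {0..1}) K"
  proof (rule continuous_on_local)
    fix z :: "'a \<times> real" assume z: "z \<in> X \<times> {0..1}"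
    let ?P = "path_component_set X (fst z)"
    have zX: "fst z \<in> X" using z by auto
    have "openin (top_of_set (X \<times> {0..1 :: real})) (?P \<times> {0..1})"
      by (intro openin_Times openin_path_component_locally_path_connected[OF lpc] openin_subtopology_self)
    moreover have "z \<in> ?P \<times> {0..1}" using z self[OF zX] by (auto simp: mem_Times_iff)
    moreover have "continuous_on (?P \<times> {0..1}) K"
    proof -
      have "K w = \<K> ?P w" if "w \<in> ?P \<times> {0..1}" for w
      proof -
        have "path_component X (fst z) (fst w)" using that by auto
        then have "path_component_set X (fst w) = ?P" by (metis path_component_eq mem_Collect_eq)
        then show ?thesis by (simp add: K_def)
      qed
      then show ?thesis
        using \<K>[rule_format, OF imageI[OF zX]] by (simp cong: continuous_on_cong)
    qed
    ultimately show "\<exists>W. openin (top_of_set (X \<times> {0..1})) W \<and> z \<in> W \<and> continuous_on W K" by blast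
  qed
  \<comment> \<open>The second map is recovered by solving \<open>\<mu> (f x, y) = K (x, t)\<close>
    for \<open>y\<close>: at time 0 this gives \<open>h\<close>, and a coincidence at time 1 would
    force \<open>K (x, 1) = e\<close>.\<close>
  define T where "T z = \<tau> (f (fst z), K z)" for z
  have Tc: "continuous_on (X \<times> {0..1}) T"
    unfolding T_def
  proof (rule continuous_on_compose2[OF c\<tau>])
    have "continuous_on (X \<times> {0..1 :: real}) (\<lambda>z. f (fst z))"
      by (rule continuous_on_compose2[OF assms(5) continuous_on_fst[OF continuous_on_id]]) auto
    then show "continuous_on (X \<times> {0..1}) (\<lambda>z. (f (fst z), K z))"
      by (rule continuous_on_Pair[OF _ Kc])
    show "(\<lambda>z. (f (fst z), K z)) ` (X \<times> {0..1}) \<subseteq> M \<times> M"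
      using fM KM by auto
  qed
  have TM: "T ` (X \<times> {0..1}) \<subseteq> M"
    using fM KM \<tau>M by (auto simp: T_def)
  have "homotopic_with_canon (\<lambda>_. True) X M h (\<lambda>x. T (x, 1))"
    by (rule homotopic_with_canon_homotopy[OF Tc TM])
       (use K0 \<tau>\<mu> fM hM in \<open>auto simp: T_def g_def\<close>)
  moreover have "Coin X f (\<lambda>x. T (x, 1)) = {}"
  proof -
    have "f x \<noteq> T (x, 1)" if x: "x \<in> X" for x
    proof
      assume "f x = T (x, 1)"
      moreover have "\<mu> (f x, T (x, 1)) = K (x, 1)"
        using \<mu>\<tau>[OF fM[OF x] KM[OF x]] by (simp add: T_def)
      ultimately show False using \<mu>e[OF fM[OF x]] K1[OF x] by simp
    qed
    then show ?thesis by (auto simp: Coin_def)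
  qed
  ultimately show ?thesis by blast
qed

end
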